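(* Let $n\geq 6$. Every homomorphism from $\mathrm{Aut}(F_n)$ to $\mathrm{Diff}^2_+(S^1)$ factors through $\mathbb{Z}/2\mathbb{Z}$ (i.e. has image of order at most $2$), and every homomorphism from $\mathrm{Aut}(F_n)$ to $\mathrm{Diff}^2_+(I)$ is trivial. The same two statements hold with $\mathrm{Aut}(F_n)$ replaced by $\mathrm{Out}(F_n)$.
   Context: $F_n$ is the free group of rank $n$; $\mathrm{Aut}(F_n)$ is its automorphism group and $\mathrm{Out}(F_n)$ its outer automorphism group. $\mathrm{Diff}^2_+(M)$ denotes the group of orientation-preserving $C^2$ diffeomorphisms of $M$, and $I=[0,1]$. *)

theory Defs
  imports "HOL-Analysis.Analysis" "HOL-Algebra.Algebra"
begin

text \<open>A letter is (b, i): generator x_i if b = True, its inverse if b = False.\<close>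

fun fg_reduced :: "(bool \<times> nat) list \<Rightarrow> bool" where
  "fg_reduced (a # b # ws) = (\<not> (snd a = snd b \<and> fst a \<noteq> fst b) \<and> fg_reduced (b # ws))"
| "fg_reduced _ = True"

fun fg_cons :: "bool \<times> nat \<Rightarrow> (bool \<times> nat) list \<Rightarrow> (bool \<times> nat) list" where
  "fg_cons a [] = [a]"
| "fg_cons a (b # ws) = (if snd a = snd b \<and> fst a \<noteq> fst b then ws else a # b # ws)"

definition free_group :: "nat \<Rightarrow> (bool \<times> nat) list monoid" where
  "free_group n = \<lparr>carrier = {ws. set ws \<subseteq> UNIV \<times> {..<n} \<and> fg_reduced ws},
                   mult = (\<lambda>x y. foldr fg_cons x y),
                   one = []\<rparr>"

definition Aut :: "('a, 'b) monoid_scheme \<Rightarrow> ('a \<Rightarrow> 'a) monoid" where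
  "Aut G = AutoGroup G"

definition Inn :: "('a, 'b) monoid_scheme \<Rightarrow> ('a \<Rightarrow> 'a) set" where
  "Inn G = {(\<lambda>x \<in> carrier G. g \<otimes>\<^bsub>G\<^esub> x \<otimes>\<^bsub>G\<^esub> inv\<^bsub>G\<^esub> g) | g. g \<in> carrier G}"

definition Out :: "('a, 'b) monoid_scheme \<Rightarrow> ('a \<Rightarrow> 'a) set monoid" where
  "Out G = AutoGroup G Mod Inn G"

definition C2_on :: "real set \<Rightarrow> (real \<Rightarrow> real) \<Rightarrow> bool" where
  "C2_on S f \<longleftrightarrow> (\<exists>f' f''. (\<forall>t\<in>S. (f has_real_derivative f' t) (at t within S)) \<and>
                          (\<forall>t\<in>S. (f' has_real_derivative f'' t) (at t within S)) \<and>
                          continuous_on S f'')"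

definition Diff2_I_set :: "(real \<Rightarrow> real) set" where
  "Diff2_I_set = {f \<in> Bij {0..1}. C2_on {0..1} f \<and> C2_on {0..1} (inv_into {0..1} f)
                                  \<and> mono_on {0..1} f}"

definition Diff2_I :: "(real \<Rightarrow> real) monoid" where
  "Diff2_I = BijGroup {0..1} \<lparr>carrier := Diff2_I_set\<rparr>"

text \<open>S^1 is the unit circle in the complex plane. A self-map f of S^1 is C^2 iff
  the map theta |-> f(cis theta) from R to R^2 = C is C^2; it preserves orientation iff its
  velocity is a positive multiple of the counterclockwise unit tangent i * f(cis theta).\<close>
definition C2_circle_map :: "(complex \<Rightarrow> complex) \<Rightarrow> bool" where
  "C2_circle_map f \<longleftrightarrow> (\<exists>g' g''.
      (\<forall>t. ((\<lambda>\<theta>. f (cis \<theta>)) has_vector_derivative g' t) (at t)) \<and>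
      (\<forall>t. (g' has_vector_derivative g'' t) (at t)) \<and> continuous_on UNIV g'')"

definition orientation_preserving_circle :: "(complex \<Rightarrow> complex) \<Rightarrow> bool" where
  "orientation_preserving_circle f \<longleftrightarrow>
     (\<forall>t. Re (vector_derivative (\<lambda>\<theta>. f (cis \<theta>)) (at t) * cnj (\<i> * f (cis t))) > 0)"

definition Diff2_S1_set :: "(complex \<Rightarrow> complex) set" where
  "Diff2_S1_set = {f \<in> Bij (sphere 0 1). C2_circle_map f \<and>
                     C2_circle_map (inv_into (sphere 0 1) f) \<and> orientation_preserving_circle f}"

definition Diff2_S1 :: "(complex \<Rightarrow> complex) monoid" where
  "Diff2_S1 = BijGroup (sphere 0 1) \<lparr>carrier := Diff2_S1_set\<rparr>"

end

(*
  An order-preserving involution of the line or the interval is the identity, and for commuting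
  involutions f, g of the circle one of f, g, fg is the identity: nontrivial involutions lift to square
  roots of the translation by 2 pi.  So a homomorphism h to Diff(S^1) kills a nontrivial element of the
  Klein four-group generated by (i j)(k l) and (i k)(j l), hence all double transpositions.  Conjugation
  by these identifies the images of all positive transvections x_i -> x_i x_j, and the commutator
  relation between transvections makes this common image trivial.  Nielsen reduction carries any
  automorphism to a signed permutation of the basis by transvections; signed permutations map into
  {1, e}, where e is the image of the inversion of one generator.  On the interval every involution is
  killed, so e = 1.  Homomorphisms from Out are pulled back to Aut.
*)
theory Submission
  imports Defs
begin

subsection \<open>Reduced words\<close>

text \<open>The two values that can survive are those of the determinant of the action on Z^n:
  transvections have determinant 1, a swap and a single inversion both have determinant -1.
  Generation of Aut(F_n) is not established separately: the descent runs on the automorphism itself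
  and keeps track of its value under \<open>h\<close>. The obstacle is that all transvections may
  fail to shorten a basis image although the images still cancel badly: if both neighbours cancel
  exactly half of a word, lengths are stuck, and a second measure has to break the tie. Once neither
  measure can drop, no reduced word is mapped to a shorter one, so the inverse automorphism sends
  letters to letters. On the circle a single involution cannot be excluded, the half turn being the
  model; only two distinct nontrivial involutions that commute can. Hence the start with a Klein
  four-group inside the double transpositions, whose three involutions are conjugate to each
  other.\<close>

definition linv :: "bool \<times> nat \<Rightarrow> bool \<times> nat" where
  "linv a = (\<not> fst a, snd a)"

definition winv :: "(bool \<times> nat) list \<Rightarrow> (bool \<times> nat) list" where
  "winv w = rev (map linv w)"

abbreviation fmul :: "(bool \<times> nat) list \<Rightarrow> (bool \<times> nat) list \<Rightarrow> (bool \<times> nat) list" where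
  "fmul \<equiv> foldr fg_cons"

lemma linv_linv [simp]: "linv (linv a) = a"
  by (simp add: linv_def)

lemma linv_neq [simp]: "linv a \<noteq> a" "a \<noteq> linv a"
  by (auto simp: linv_def prod_eq_iff)

lemma linv_eq_iff [simp]: "linv a = linv b \<longleftrightarrow> a = b"
  by (metis linv_linv)

lemma snd_linv [simp]: "snd (linv a) = snd a"
  by (simp add: linv_def)

lemma snd_eq_iff_linv: "snd a = snd b \<longleftrightarrow> a = b \<or> a = linv b"
  by (auto simp: linv_def prod_eq_iff)

lemma fg_cons_Cons: "fg_cons a (b # ws) = (if b = linv a then ws else a # b # ws)"
  by (auto simp: linv_def prod_eq_iff)

lemma fg_reduced_Cons_Cons: "fg_reduced (a # b # ws) \<longleftrightarrow> b \<noteq> linv a \<and> fg_reduced (b # ws)"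
  by (auto simp: linv_def prod_eq_iff)

declare fg_cons.simps(2) [simp del] fg_reduced.simps(1) [simp del]
declare fg_cons_Cons [simp] fg_reduced_Cons_Cons [simp]

lemma fg_reduced_Cons:
  "fg_reduced (a # w) \<longleftrightarrow> fg_reduced w \<and> (w \<noteq> [] \<longrightarrow> hd w \<noteq> linv a)"
  by (cases w) auto

lemma fg_reduced_append:
  "fg_reduced (u @ v) \<longleftrightarrow>
     fg_reduced u \<and> fg_reduced v \<and> (u \<noteq> [] \<and> v \<noteq> [] \<longrightarrow> hd v \<noteq> linv (last u))"
  by (induction u) (auto simp: fg_reduced_Cons)

lemma fg_reduced_fg_cons: "fg_reduced w \<Longrightarrow> fg_reduced (fg_cons a w)"
  by (cases w) (auto simp: fg_reduced_Cons)

lemma fg_reduced_fmul: "fg_reduced v \<Longrightarrow> fg_reduced (fmul u v)"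
  by (induction u) (auto simp: fg_reduced_fg_cons)

lemma fg_cons_linv: "fg_reduced w \<Longrightarrow> fg_cons a (fg_cons (linv a) w) = w"
proof (cases w)
  case (Cons b w')
  then show "fg_reduced w \<Longrightarrow> fg_cons a (fg_cons (linv a) w) = w" by (cases w') auto
qed simp

lemma fmul_fg_cons: "fg_reduced v \<Longrightarrow> fmul (fg_cons a u) v = fg_cons a (fmul u v)"
proof (cases u)
  case (Cons b u')
  assume v: "fg_reduced v"
  show ?thesis
    using fg_cons_linv[OF fg_reduced_fmul[OF v, of u'], of a] Cons by simp
qed simp

lemma fmul_assoc: "fg_reduced w \<Longrightarrow> fmul (fmul u v) w = fmul u (fmul v w)"
  by (induction u) (auto simp: fmul_fg_cons)

lemma set_fg_cons: "set (fg_cons a w) \<subseteq> insert a (set w)"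
  by (cases w) auto

lemma set_fmul: "set (fmul u v) \<subseteq> set u \<union> set v"
  by (induction u) (use set_fg_cons in fastforce)+

lemma fmul_append: "fg_reduced (u @ v) \<Longrightarrow> fmul u v = u @ v"
proof (induction u)
  case (Cons a u)
  then show ?case by (cases "u @ v") (auto simp: fg_reduced_Cons)
qed simp

lemma fmul_Nil_right: "fg_reduced u \<Longrightarrow> fmul u [] = u"
  using fmul_append[of u "[]"] by simp

lemma winv_simps [simp]:
  "winv [] = []" "winv (a # w) = winv w @ [linv a]" "winv (u @ v) = winv v @ winv u"
  "winv (winv w) = w" "length (winv w) = length w" "winv w = [] \<longleftrightarrow> w = []"
  by (auto simp: winv_def rev_map comp_def)

lemma fg_reduced_winv [simp]: "fg_reduced (winv w) \<longleftrightarrow> fg_reduced w"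
proof -
  have "fg_reduced (winv w)" if "fg_reduced w" for w
    using that
  proof (induction w)
    case (Cons a w)
    then show ?case
      by (cases w) (auto simp: fg_reduced_append fg_reduced_Cons)
  qed simp
  from this[of w] this[of "winv w"] show ?thesis by auto
qed

lemma snd_set_winv: "snd ` set (winv w) = snd ` set w"
  by (induction w) auto

lemma fmul_winv_cancel: "fg_reduced v \<Longrightarrow> fmul (winv u) (fmul u v) = v"
proof (induction u)
  case (Cons a u)
  have "fmul (winv (a # u)) (fmul (a # u) v) = fmul (winv u) (fg_cons (linv a) (fg_cons (linv (linv a)) (fmul u v)))"
    by simp
  also have "\<dots> = v"
    using Cons by (subst fg_cons_linv) (auto simp: fg_reduced_fmul)
  finally show ?case .
qed simp

lemma fmul_winv_left: "fg_reduced u \<Longrightarrow> fmul (winv u) u = []"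
  using fmul_winv_cancel[of "[]" u] by (simp add: fmul_Nil_right)

lemma fmul_winv_right: "fg_reduced u \<Longrightarrow> fmul u (winv u) = []"
  using fmul_winv_left[of "winv u"] by simp

lemma winv_fmul:
  assumes "fg_reduced u" "fg_reduced v"
  shows "winv (fmul u v) = fmul (winv v) (winv u)"
proof -
  let ?w = "fmul u v"
  have r: "fg_reduced ?w" using assms fg_reduced_fmul by blast
  have "fmul (winv v) (winv u) = fmul (winv v) (fmul (winv u) (fmul ?w (winv ?w)))"
    using r by (simp add: fmul_winv_right fmul_Nil_right assms)
  also have "\<dots> = fmul (fmul (winv v) (fmul (winv u) ?w)) (winv ?w)"
    using r by (simp add: fmul_assoc)
  also have "\<dots> = winv ?w"
    using assms by (simp add: fmul_winv_cancel fmul_winv_left)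
  finally show ?thesis by simp
qed

text \<open>Letters cancel only at the junction, so induction on \<open>v\<close> compares its head
  with the last letter of \<open>u\<close> and stops at the first pair that is not mutually
  inverse.\<close>

lemma fmul_cancellation:
  assumes "fg_reduced u" "fg_reduced v"
  obtains u' p v' where "u = u' @ winv p" "v = p @ v'" "fmul u v = u' @ v'"
  using assms
proof (induction v arbitrary: u thesis)
  case Nil
  then show ?case using Nil(1)[of u "[]" "[]"] by (simp add: fmul_Nil_right)
next
  case (Cons a v)
  show ?case
  proof (cases "u \<noteq> [] \<and> last u = linv a")
    case True
    then obtain u1 where u1: "u = u1 @ [linv a]" by (metis append_butlast_last_id)
    with Cons.prems have "fg_reduced u1" "fg_reduced v"
      by (auto simp: fg_reduced_append fg_reduced_Cons)
    then obtain u' p v' where "u1 = u' @ winv p" "v = p @ v'" "fmul u1 v = u' @ v'"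
      using Cons.IH by blast
    then show ?thesis using Cons.prems(1)[of u' "a # p" v'] u1 by simp
  next
    case False
    then have "fg_reduced (u @ a # v)"
      using Cons.prems by (auto simp: fg_reduced_append fg_reduced_Cons)
    then show ?thesis using Cons.prems(1)[of u "[]" "a # v"] by (simp add: fmul_append)
  qed
qed

section \<open>Homomorphisms given by their values on letters\<close>

definition word_ext :: "(bool \<times> nat \<Rightarrow> (bool \<times> nat) list) \<Rightarrow> (bool \<times> nat) list \<Rightarrow> (bool \<times> nat) list" where
  "word_ext f w = foldr (\<lambda>a. fmul (f a)) w []"

lemma word_ext_simps [simp]:
  "word_ext f [] = []" "word_ext f (a # w) = fmul (f a) (word_ext f w)"
  by (auto simp: word_ext_def)

text \<open>Values are prescribed on generators and on their inverses, which keeps both signs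
  symmetric in later formulas. The compatibility condition makes \<open>word_ext\<close> blind to
  the cancellation of adjacent inverse letters, hence multiplicative.\<close>

definition letter_map :: "nat \<Rightarrow> (bool \<times> nat \<Rightarrow> (bool \<times> nat) list) \<Rightarrow> bool" where
  "letter_map n f \<longleftrightarrow> (\<forall>a. snd a < n \<longrightarrow> f a \<in> carrier (free_group n) \<and> f (linv a) = winv (f a))"

lemma carrier_free_group:
  "w \<in> carrier (free_group n) \<longleftrightarrow> (\<forall>a\<in>set w. snd a < n) \<and> fg_reduced w"
  by (auto simp: free_group_def)

lemma mult_free_group [simp]: "x \<otimes>\<^bsub>free_group n\<^esub> y = fmul x y"
  by (simp add: free_group_def)

lemma one_free_group [simp]: "\<one>\<^bsub>free_group n\<^esub> = []"
  by (simp add: free_group_def)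

lemma snd_less_of_mem: "w \<in> carrier (free_group n) \<Longrightarrow> a \<in> set w \<Longrightarrow> snd a < n"
  by (simp add: carrier_free_group)

lemma letter_mapD:
  assumes "letter_map n f" "snd a < n"
  shows "f a \<in> carrier (free_group n)" "f (linv a) = winv (f a)"
  using assms unfolding letter_map_def by blast+

lemma fmul_closed:
  "x \<in> carrier (free_group n) \<Longrightarrow> y \<in> carrier (free_group n) \<Longrightarrow> fmul x y \<in> carrier (free_group n)"
  using set_fmul[of x y] unfolding carrier_free_group by (blast intro: fg_reduced_fmul)

lemma winv_closed: "x \<in> carrier (free_group n) \<Longrightarrow> winv x \<in> carrier (free_group n)"
  using snd_set_winv[of x] unfolding carrier_free_group fg_reduced_winv
  by (metis image_iff)

lemma group_free_group: "group (free_group n)"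
proof (rule groupI)
  fix x assume "x \<in> carrier (free_group n)"
  then show "\<exists>y\<in>carrier (free_group n). y \<otimes>\<^bsub>free_group n\<^esub> x = \<one>\<^bsub>free_group n\<^esub>"
    by (intro bexI[of _ "winv x"]) (simp_all add: winv_closed, simp add: carrier_free_group fmul_winv_left)
qed (auto simp: fmul_closed, auto simp: carrier_free_group fmul_assoc)

lemma word_ext_closed:
  assumes "letter_map n f" "\<forall>a\<in>set w. snd a < n"
  shows "word_ext f w \<in> carrier (free_group n)"
  using assms(2)
proof (induction w)
  case (Cons a w)
  then show ?case by (simp add: fmul_closed letter_mapD(1)[OF assms(1), of a])
qed (simp add: carrier_free_group)

lemma word_ext_fg_cons:
  assumes "letter_map n f" "\<forall>b\<in>set (a # w). snd b < n"
  shows "word_ext f (fg_cons a w) = fmul (f a) (word_ext f w)"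
proof (cases "w \<noteq> [] \<and> hd w = linv a")
  case True
  then obtain w' where w': "w = linv a # w'" by (metis list.collapse)
  have "fmul (f a) (fmul (f (linv a)) (word_ext f w')) = fmul (winv (winv (f a))) (fmul (winv (f a)) (word_ext f w'))"
    using letter_mapD(2)[OF assms(1)] assms(2) by simp
  also have "\<dots> = word_ext f w'"
    using assms word_ext_closed[OF assms(1), of w'] unfolding w'
    by (intro fmul_winv_cancel) (auto simp: carrier_free_group)
  finally show ?thesis using w' by simp
next
  case False
  then have "fg_cons a w = a # w" by (cases w) auto
  then show ?thesis by simp
qed

lemma word_ext_fmul:
  assumes "letter_map n f" "\<forall>a\<in>set u. snd a < n" "\<forall>a\<in>set v. snd a < n"
  shows "word_ext f (fmul u v) = fmul (word_ext f u) (word_ext f v)"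
  using assms(2)
proof (induction u)
  case (Cons a u)
  have "word_ext f (fmul (a # u) v) = fmul (f a) (word_ext f (fmul u v))"
    using Cons.prems assms(3) set_fmul[of u v] word_ext_fg_cons[OF assms(1), of a "fmul u v"]
    by (simp add: ball_Un) (meson Un_iff subsetD)
  also have "\<dots> = fmul (f a) (fmul (word_ext f u) (word_ext f v))"
    using Cons by simp
  also have "\<dots> = fmul (word_ext f (a # u)) (word_ext f v)"
    using word_ext_closed[OF assms(1,3)] by (simp add: fmul_assoc carrier_free_group)
  finally show ?case .
qed simp

subsection \<open>Nielsen reduction\<close>

text \<open>Each cancelled pair costs two letters, so lengths alone determine how long the cancelled
  segment is; no segment has to be chosen.\<close>

definition cancelled :: "(bool \<times> nat) list \<Rightarrow> (bool \<times> nat) list \<Rightarrow> nat" where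
  "cancelled u v = (length u + length v - length (fmul u v)) div 2"

lemma cancellationE:
  assumes "fg_reduced u" "fg_reduced v"
  obtains u' p v' where "u = u' @ winv p" "v = p @ v'" "fmul u v = u' @ v'" "length p = cancelled u v"
proof -
  from fmul_cancellation[OF assms] obtain u' p v' where "u = u' @ winv p" "v = p @ v'" "fmul u v = u' @ v'" .
  then show thesis by (intro that[of u' p v']) (auto simp: cancelled_def)
qed

lemma cancelled_eq: 
  assumes "fg_reduced u" "fg_reduced v"
  shows "length (fmul u v) + 2 * cancelled u v = length u + length v"
proof -
  obtain u' p v' where "u = u' @ winv p" "v = p @ v'" "fmul u v = u' @ v'" "length p = cancelled u v"
    using cancellationE[OF assms] .
  then show ?thesis by simp
qed

text \<open>If half of \<open>u\<close> cancelled in \<open>u u\<close>, the word would be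
  letterwise inverse to its own reversal. At the centre this makes two neighbouring letters mutually
  inverse (even length) or a letter its own inverse (odd length).\<close>

lemma cancelled_self:
  assumes "fg_reduced u" "u \<noteq> []"
  shows "2 * cancelled u u < length u"
proof (rule ccontr)
  assume *: "\<not> ?thesis"
  obtain u' p v' where u: "u = u' @ winv p" "u = p @ v'" and p: "length p = cancelled u u"
    using cancellationE[OF assms(1,1)] by blast
  have len: "length u \<le> 2 * length p" "length u = length u' + length p" 
    using * p arg_cong[OF u(1), of length] by auto
  have inverse_letters: "u ! i = linv (u ! (length u - 1 - i))" if "i < length p" for i
  proof -
    let ?j = "length u - 1 - i"
    have "u ! ?j = winv p ! (?j - length u')"
      using that len by (subst u(1), subst nth_append) auto
    also have "?j - length u' = length p - 1 - i" using len that by simp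
    also have "winv p ! (length p - 1 - i) = linv (p ! i)"
      using that unfolding winv_def by (subst rev_nth) auto
    also have "p ! i = u ! i"
      using that by (subst u(2)) (auto simp: nth_append)
    finally show ?thesis by simp
  qed
  show False
  proof (cases "even (length u)")
    case True
    then obtain k where k: "length u = 2 * Suc k"
      using assms(2) by (metis evenE length_0_conv mult_0_right not0_implies_Suc)
    have "u ! k = linv (u ! Suc k)"
      using inverse_letters[of k] k len by simp
    moreover have "u = take k u @ u ! k # u ! Suc k # drop (Suc (Suc k)) u"
      using k by (simp add: Cons_nth_drop_Suc)
    ultimately show False using assms(1)
      by (metis fg_reduced_Cons_Cons fg_reduced_append linv_linv)
  next
    case False
    then obtain k where k: "length u = 2 * k + 1" by (metis oddE)
    then show False using inverse_letters[of k] len by simp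
  qed
qed

text \<open>Under the two Nielsen conditions, cancellation in a product of the words \<open>f a\<close> never reaches
  the middle of a factor; the invariant records that a nonempty initial segment of the leftmost factor
  survives and that every further factor contributes at least one letter.\<close>

lemma nielsen_reduced_prefix:
  assumes red: "\<And>a. a \<in> A \<Longrightarrow> fg_reduced (f a) \<and> f a \<noteq> []"
    and N1: "\<And>a b. a \<in> A \<Longrightarrow> b \<in> A \<Longrightarrow> b \<noteq> linv a \<Longrightarrow> 2 * cancelled (f a) (f b) \<le> length (f a)"
    and N2: "\<And>a b c. a \<in> A \<Longrightarrow> b \<in> A \<Longrightarrow> c \<in> A \<Longrightarrow> b \<noteq> linv a \<Longrightarrow> c \<noteq> linv b \<Longrightarrow>
               cancelled (f a) (f b) + cancelled (f b) (f c) < length (f b)"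
    and y: "set (b # y) \<subseteq> A" "fg_reduced (b # y)"
  shows "\<exists>t r. word_ext f (b # y) = take t (f b) @ r \<and> length y \<le> length r \<and> 0 < t \<and> t \<le> length (f b) \<and>
           t = length (f b) - (if y = [] then 0 else cancelled (f b) (f (hd y))) \<and> fg_reduced (take t (f b) @ r)"
  using y
proof (induction y arbitrary: b)
  case Nil
  then show ?case using red[of b]
    by (intro exI[of _ "length (f b)"] exI[of _ "[]"]) (auto simp: fmul_Nil_right)
next
  case (Cons b y a)
  then have A: "a \<in> A" "b \<in> A" and ne: "b \<noteq> linv a" by auto
  obtain t r where t: "word_ext f (b # y) = take t (f b) @ r" "length y \<le> length r" "0 < t" "t \<le> length (f b)"
    "t = length (f b) - (if y = [] then 0 else cancelled (f b) (f (hd y)))" "fg_reduced (take t (f b) @ r)"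
    using Cons.IH[of b] Cons.prems by auto
  obtain u p v where p: "f a = u @ winv p" "f b = p @ v" "fmul (f a) (f b) = u @ v"
    "length p = cancelled (f a) (f b)"
    using cancellationE red A by metis
  have len_p: "length p < t"
  proof (cases "y = []")
    case True
    \<comment> \<open>With no further factor the third letter in N2 may be \<open>b\<close> itself,
      since \<open>b\<close> is not its own inverse.\<close>
    then show ?thesis using t(5) p(4) N2[of a b b] A ne by simp
  next
    case False
    then have "hd y \<in> A" "hd y \<noteq> linv b" using Cons.prems by (cases y; auto)+
    then have "cancelled (f a) (f b) + cancelled (f b) (f (hd y)) < length (f b)"
      using N2 A ne by blast
    then show ?thesis using t(5) p(4) False by simp
  qed
  \<comment> \<open>\<open>s\<close> is the part of \<open>f b\<close> that survives the
    cancellation on both sides. Being nonempty, it separates \<open>u\<close> from \<open>r\<close>,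
    so no new cancellation can arise between them.\<close>
  define s where "s = take (t - length p) v"
  have s: "take t (f b) = p @ s" "s \<noteq> []"
    using len_p t(3,4) arg_cong[OF p(2), of length] by (auto simp: s_def p(2))
  have red_uv: "fg_reduced (u @ v)" using p(3) red[OF A(2)] fg_reduced_fmul by metis
  have red_sr: "fg_reduced (s @ r)" using t(6) s by (auto simp: fg_reduced_append)
  have red': "fg_reduced (u @ s @ r)"
    using red_uv red_sr s(2) by (auto simp: fg_reduced_append s_def)
  have "word_ext f (a # b # y) = fmul (u @ winv p) (p @ s @ r)"
    using t(1) s p(1) by simp
  also have "\<dots> = fmul u (fmul (winv p) (fmul p (s @ r)))"
    using t(6) s by (simp add: fmul_append)
  also have "\<dots> = u @ s @ r"
    using red_sr red' by (simp add: fmul_winv_cancel fmul_append)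
  finally have ext: "word_ext f (a # b # y) = u @ s @ r" .
  have u: "u = take (length u) (f a)" by (simp add: p(1))
  have "0 < length u"
    using N1[OF A ne] p(4) arg_cong[OF p(1), of length] red[OF A(1)] by auto
  moreover have "length (b # y) \<le> length (s @ r)" using t(2) s(2) by (cases s) auto
  ultimately show ?case
    using ext u red' p(1,4) by (intro exI[of _ "length u"] exI[of _ "s @ r"]) auto
qed

lemma length_word_ext_ge:
  assumes "\<And>a. a \<in> A \<Longrightarrow> fg_reduced (f a) \<and> f a \<noteq> []"
    and "\<And>a b. a \<in> A \<Longrightarrow> b \<in> A \<Longrightarrow> b \<noteq> linv a \<Longrightarrow> 2 * cancelled (f a) (f b) \<le> length (f a)"
    and "\<And>a b c. a \<in> A \<Longrightarrow> b \<in> A \<Longrightarrow> c \<in> A \<Longrightarrow> b \<noteq> linv a \<Longrightarrow> c \<noteq> linv b \<Longrightarrow>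
               cancelled (f a) (f b) + cancelled (f b) (f c) < length (f b)"
    and "set y \<subseteq> A" "fg_reduced y"
  shows "length y \<le> length (word_ext f y)"
proof (cases y)
  case (Cons b y')
  from nielsen_reduced_prefix[where A = A and f = f and b = b and y = y', OF assms(1-3)] assms(4,5) Cons
  obtain t r where "word_ext f y = take t (f b) @ r" "length y' \<le> length r" "0 < t" "t \<le> length (f b)"
    by auto
  then show ?thesis using Cons by simp
qed simp

text \<open>The word read as a numeral in base \<open>2 * n\<close>. On words of equal length over
  the first \<open>n\<close> generators this is a lexicographic order, but with values in the
  natural numbers, so that ranks can be added and used as a measure.\<close>

definition word_rank :: "nat \<Rightarrow> (bool \<times> nat) list \<Rightarrow> nat" where
  "word_rank n w = foldl (\<lambda>r a. r * (2 * n) + (2 * snd a + of_bool (fst a))) 0 w"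

lemma word_rank_snoc: "word_rank n (w @ [a]) = word_rank n w * (2 * n) + (2 * snd a + of_bool (fst a))"
  by (simp add: word_rank_def)

lemma word_rank_append_less:
  assumes "word_rank n p < word_rank n q" "n > 0" "\<forall>a\<in>set s. snd a < n"
  shows "word_rank n (p @ s) < word_rank n (q @ s)"
  using assms(3)
proof (induction s rule: rev_induct)
  case (snoc a s)
  then show ?case using assms(2) word_rank_snoc[of n "p @ s" a] word_rank_snoc[of n "q @ s" a] by simp
qed (use assms in simp)

lemma word_rank_inj:
  assumes "length p = length q" "\<forall>a\<in>set p \<union> set q. snd a < n" "word_rank n p = word_rank n q"
  shows "p = q"
  using assms
proof (induction p arbitrary: q rule: rev_induct)
  case (snoc a p)
  then obtain q' b where q: "q = q' @ [b]" by (cases q rule: rev_cases) auto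
  define d where "d x = 2 * snd x + of_bool (fst x)" for x :: "bool \<times> nat"
  have d: "d a < 2 * n" "d b < 2 * n" using snoc.prems q by (auto simp: d_def)
  have eq: "word_rank n p * (2 * n) + d a = word_rank n q' * (2 * n) + d b"
    using snoc.prems(3) by (simp add: q word_rank_snoc d_def)
  have "d a = d b" using arg_cong[OF eq, of "\<lambda>x. x mod (2 * n)"] d by simp
  moreover have "snd x = d x div 2" "fst x \<longleftrightarrow> odd (d x)" for x by (auto simp: d_def)
  ultimately have "a = b" by (simp add: prod_eq_iff)
  moreover have "word_rank n p = word_rank n q'" using eq \<open>d a = d b\<close> d by simp
  ultimately show ?case using snoc.IH[of q'] snoc.prems q by auto
qed simp

text \<open>Tie-breaker of Nielsen reduction: a step that keeps the length replaces an initial segment of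
  one of the two halves of a word (read from its two ends) by a segment of smaller rank.\<close>

definition half_rank :: "nat \<Rightarrow> (bool \<times> nat) list \<Rightarrow> nat" where
  "half_rank n w = word_rank n (take ((length w + 1) div 2) w) + word_rank n (take ((length w + 1) div 2) (winv w))"

lemma half_rank_winv: "half_rank n (winv w) = half_rank n w"
  by (simp add: half_rank_def)

text \<open>Since \<open>p\<close> is at most as long as \<open>u\<close>, the first half lies
  inside \<open>u\<close> and does not change; the half read from the other end begins with
  \<open>p\<close>, respectively \<open>q\<close>.\<close>

lemma half_rank_less:
  assumes "word_rank n q < word_rank n p" "length q = length p" "length p \<le> length u" "n > 0"
    "\<forall>a\<in>set u. snd a < n"
  shows "half_rank n (u @ winv q) < half_rank n (u @ winv p)"
proof -
  let ?k = "(length u + length p + 1) div 2"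
  have k: "?k \<le> length u" "length p \<le> ?k" using assms(3) by auto
  have "word_rank n (q @ take (?k - length p) (winv u)) < word_rank n (p @ take (?k - length p) (winv u))"
  proof (rule word_rank_append_less)
    show "\<forall>a\<in>set (take (?k - length p) (winv u)). snd a < n"
      using assms(5) snd_set_winv[of u] by (metis image_iff in_set_takeD)
  qed (use assms in auto)
  then show ?thesis using k assms(2) by (simp add: half_rank_def)
qed

definition shorter :: "nat \<Rightarrow> (bool \<times> nat) list \<Rightarrow> (bool \<times> nat) list \<Rightarrow> bool" where
  "shorter n v w \<longleftrightarrow> length v < length w \<or> length v = length w \<and> half_rank n v < half_rank n w"

text \<open>Irreducibility in length bounds every cancellation by half of either factor. The second
  Nielsen condition can then fail only if \<open>f b\<close> is \<open>p @ winv q\<close> with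
  halves of equal length, cancelled by \<open>f a\<close> and \<open>f c\<close>. Exchanging
  \<open>p\<close> and \<open>q\<close> at the end of \<open>f a\<close> or of the inverse of
  \<open>f c\<close> keeps the length, and one of the two exchanges lowers the rank unless
  \<open>p = q\<close>, which would make \<open>f b\<close> trivial.\<close>

lemma nielsen_step:
  assumes f: "letter_map n f" and ne: "\<And>a. snd a < n \<Longrightarrow> f a \<noteq> []"
    and irreducible: "\<And>a b. snd a < n \<Longrightarrow> snd b < n \<Longrightarrow> snd a \<noteq> snd b \<Longrightarrow> \<not> shorter n (fmul (f a) (f b)) (f a)"
    and y: "y \<in> carrier (free_group n)"
  shows "length y \<le> length (word_ext f y)"
proof (cases "n = 0")
  case True
  then show ?thesis using y by (cases y) (auto simp: carrier_free_group)
next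
  case False
  define A where "A = {a :: bool \<times> nat. snd a < n}"
  have red: "fg_reduced (f a) \<and> f a \<noteq> []" and inv: "f (linv a) = winv (f a)" if "a \<in> A" for a
    using letter_mapD[OF f, of a] ne that by (simp_all add: A_def carrier_free_group)
  have A_inv: "linv a \<in> A" if "a \<in> A" for a using that by (simp add: A_def)
  \<comment> \<open>Irreducibility speaks of letters with different indices; the square of a word is
    handled by \<open>cancelled_self\<close>.\<close>
  have len1: "length (f a) \<le> length (fmul (f a) (f b))" if "a \<in> A" "b \<in> A" "b \<noteq> linv a" for a b
  proof (cases "snd a = snd b")
    case True
    then have "a = b" using that snd_eq_iff_linv by auto
    then show ?thesis
      using cancelled_self[of "f a"] cancelled_eq[of "f a" "f a"] red[OF that(1)] by simp
  next
    case False
    then show ?thesis using irreducible[of a b] that by (auto simp: shorter_def A_def)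
  qed
  have len2: "length (f b) \<le> length (fmul (f a) (f b))" if "a \<in> A" "b \<in> A" "b \<noteq> linv a" for a b
    using len1[of "linv b" "linv a"] that A_inv inv red
    by (metis linv_linv winv_fmul winv_simps(5))
  have N1: "2 * cancelled (f a) (f b) \<le> length (f a)" "2 * cancelled (f a) (f b) \<le> length (f b)"
    if "a \<in> A" "b \<in> A" "b \<noteq> linv a" for a b
    using len1[OF that] len2[OF that] cancelled_eq[of "f a" "f b"] red that by fastforce+
  have N2: "cancelled (f a) (f b) + cancelled (f b) (f c) < length (f b)"
    if abc: "a \<in> A" "b \<in> A" "c \<in> A" "b \<noteq> linv a" "c \<noteq> linv b" for a b c
  proof (rule ccontr)
    assume "\<not> ?thesis"
    then have half: "2 * cancelled (f a) (f b) = length (f b)" "2 * cancelled (f b) (f c) = length (f b)"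
      using N1[of a b] N1[of b c] abc by auto
    have distinct: "snd a \<noteq> snd b" "snd c \<noteq> snd b"
      using half cancelled_self[of "f b"] red[OF abc(2)] abc(4,5)
      by (metis less_irrefl snd_eq_iff_linv)+
    obtain u p v where p: "f a = u @ winv p" "f b = p @ v" "fmul (f a) (f b) = u @ v"
      "length p = cancelled (f a) (f b)"
      using cancellationE red abc by metis
    obtain v2 q w where q: "f b = v2 @ winv q" "f c = q @ w" "fmul (f b) (f c) = v2 @ w"
      "length q = cancelled (f b) (f c)"
      using cancellationE red abc by metis
    have len: "length p = length q" using p q half by simp
    have "length v2 = length p"
      using arg_cong[OF q(1), of length] half q(4) p(4) by simp
    then have v: "v2 = p" "v = winv q" using p(2) q(1) by auto
    have fb: "f b = p @ winv q" using p(2) v by simp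
    have "p \<noteq> q"
    proof
      assume "p = q"
      then have "f b = fmul p (winv p)" using fb red[OF abc(2)] by (metis fmul_append)
      moreover have "fg_reduced p" using fb red[OF abc(2)] by (simp add: fg_reduced_append)
      ultimately show False using red[OF abc(2)] fmul_winv_right by simp
    qed
    have carr: "\<forall>x\<in>set (f d). snd x < n" if "d \<in> A" for d
      using letter_mapD[OF f, of d] that by (simp add: A_def carrier_free_group)
    have pq: "\<forall>x\<in>set p \<union> set q. snd x < n"
      using carr[OF abc(2)] carr[OF abc(3)] fb q(2) by auto
    have not1: "\<not> word_rank n q < word_rank n p"
    proof
      assume "word_rank n q < word_rank n p"
      then have "half_rank n (u @ winv q) < half_rank n (u @ winv p)"
        using len N1(1)[of a b] abc half p(4) arg_cong[OF p(1), of length] False carr[OF abc(1)] p(1)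
        by (intro half_rank_less) auto
      then have "shorter n (fmul (f a) (f b)) (f a)"
        using p v len by (simp add: shorter_def)
      then show False using irreducible[of a b] distinct abc by (auto simp: A_def)
    qed
    have not2: "\<not> word_rank n p < word_rank n q"
    proof
      assume less: "word_rank n p < word_rank n q"
      \<comment> \<open>Mirror case: inverting \<open>f c\<close> moves the segment \<open>q\<close>
        to the end of the word, where right multiplication by the inverse of \<open>f b\<close>
        replaces it by \<open>p\<close>.\<close>
      have fc: "f (linv c) = winv w @ winv q" using inv[OF abc(3)] q(2) by simp
      have prod: "fmul (f (linv c)) (f (linv b)) = winv w @ winv p"
        using q(3) v(1) inv abc winv_fmul[of "f b" "f c"] red by simp
      have "half_rank n (winv w @ winv p) < half_rank n (winv w @ winv q)"
      proof (intro half_rank_less less)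
        show "length q \<le> length (winv w)"
          using N1(2)[of b c] abc half q(4) arg_cong[OF q(2), of length] by simp
        show "\<forall>a\<in>set (winv w). snd a < n"
          using carr[OF A_inv[OF abc(3)]] fc by simp
      qed (use len False in auto)
      then have "shorter n (fmul (f (linv c)) (f (linv b))) (f (linv c))"
        unfolding shorter_def prod unfolding fc using len by simp
      then show False using irreducible[of "linv c" "linv b"] distinct abc by (auto simp: A_def)
    qed
    have "word_rank n p = word_rank n q" using not1 not2 by simp
    then show False using word_rank_inj[OF len pq] \<open>p \<noteq> q\<close> by simp
  qed
  show ?thesis
  proof (rule length_word_ext_ge)
    show "set y \<subseteq> A" "fg_reduced y" using y by (auto simp: A_def carrier_free_group)
  qed (use red N1 N2 in auto)
qed

subsection \<open>Automorphism groups\<close>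

lemma autoD:
  assumes "\<alpha> \<in> auto G"
  shows "\<alpha> \<in> hom G G" "inj_on \<alpha> (carrier G)"
  using assms by (simp_all add: auto_def Bij_def bij_betw_def)

context group begin

lemma conj_mult:
  assumes "g \<in> carrier G" "k \<in> carrier G" "x \<in> carrier G"
  shows "g \<otimes> (k \<otimes> x \<otimes> inv k) \<otimes> inv g = (g \<otimes> k) \<otimes> x \<otimes> inv (g \<otimes> k)"
  using assms by (simp add: inv_mult_group m_assoc)

lemma Inn_subset_auto: "Inn G \<subseteq> auto G"
proof
  fix c assume "c \<in> Inn G"
  then obtain g where g: "g \<in> carrier G" and c: "c = (\<lambda>x\<in>carrier G. g \<otimes> x \<otimes> inv g)"
    by (auto simp: Inn_def)
  have inverse: "g \<otimes> (inv g \<otimes> x \<otimes> inv (inv g)) \<otimes> inv g = x" "inv g \<otimes> (g \<otimes> x \<otimes> inv g) \<otimes> inv (inv g) = x"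
    if "x \<in> carrier G" for x
    using that g conj_mult[of g "inv g" x] conj_mult[of "inv g" g x] by simp_all
  have "c \<in> hom G G"
  proof (rule homI)
    fix x y assume xy: "x \<in> carrier G" "y \<in> carrier G"
    have "g \<otimes> (x \<otimes> y) \<otimes> inv g = (g \<otimes> x \<otimes> inv g) \<otimes> (g \<otimes> y \<otimes> inv g)"
      using g xy inv_solve_left[of g] by (simp add: m_assoc) (simp add: m_assoc[symmetric])
    then show "c (x \<otimes> y) = c x \<otimes> c y" using xy by (simp add: c)
  qed (use g in \<open>simp add: c\<close>)
  moreover have "bij_betw c (carrier G) (carrier G)"
    by (rule bij_betwI[of _ _ _ "\<lambda>x. inv g \<otimes> x \<otimes> inv (inv g)"]) (use g inverse in \<open>auto simp: c\<close>)
  ultimately show "c \<in> auto G" by (simp add: auto_def Bij_def c)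
qed

lemma AutoGroup_simps:
  "carrier (AutoGroup G) = auto G"
  "\<alpha> \<in> auto G \<Longrightarrow> \<beta> \<in> auto G \<Longrightarrow> \<alpha> \<otimes>\<^bsub>AutoGroup G\<^esub> \<beta> = compose (carrier G) \<alpha> \<beta>"
  "\<one>\<^bsub>AutoGroup G\<^esub> = (\<lambda>x\<in>carrier G. x)"
  by (auto simp: AutoGroup_def BijGroup_def auto_def)

lemma Inn_mult:
  assumes "g \<in> carrier G" "k \<in> carrier G"
  shows "compose (carrier G) (\<lambda>x\<in>carrier G. g \<otimes> x \<otimes> inv g) (\<lambda>x\<in>carrier G. k \<otimes> x \<otimes> inv k) =
    (\<lambda>x\<in>carrier G. (g \<otimes> k) \<otimes> x \<otimes> inv (g \<otimes> k))"
  using assms by (auto simp: compose_def conj_mult)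

lemma Inn_normal: "Inn G \<lhd> AutoGroup G"
proof -
  interpret A: group "AutoGroup G" by (rule AutoGroup)
  have in_Inn: "(\<lambda>x\<in>carrier G. g \<otimes> x \<otimes> inv g) \<in> Inn G" if "g \<in> carrier G" for g
    using that by (auto simp: Inn_def)
  note in_auto = subsetD[OF Inn_subset_auto in_Inn]
  show ?thesis
  proof (rule A.normal_invI)
    show "subgroup (Inn G) (AutoGroup G)"
    proof (rule A.subgroupI)
      show "Inn G \<subseteq> carrier (AutoGroup G)" using Inn_subset_auto by (simp add: AutoGroup_simps)
      show "Inn G \<noteq> {}" using in_Inn[of \<one>] by auto
    next
      fix c assume "c \<in> Inn G"
      then obtain g where g: "g \<in> carrier G" and c: "c = (\<lambda>x\<in>carrier G. g \<otimes> x \<otimes> inv g)"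
        by (auto simp: Inn_def)
      have "inv\<^bsub>AutoGroup G\<^esub> c = (\<lambda>x\<in>carrier G. inv g \<otimes> x \<otimes> inv (inv g))"
      proof (rule A.inv_equality)
        show "(\<lambda>x\<in>carrier G. inv g \<otimes> x \<otimes> inv (inv g)) \<otimes>\<^bsub>AutoGroup G\<^esub> c = \<one>\<^bsub>AutoGroup G\<^esub>"
          unfolding c AutoGroup_simps(2)[OF in_auto[OF inv_closed[OF g]] in_auto[OF g]] 
            Inn_mult[OF inv_closed[OF g] g] AutoGroup_simps(3)
          using g by (intro restrict_ext) simp
      qed (use g c in_auto in_auto[OF inv_closed[OF g]] in \<open>simp_all add: AutoGroup_simps\<close>)
      then show "inv\<^bsub>AutoGroup G\<^esub> c \<in> Inn G" using in_Inn[of "inv g"] g by simp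
    next
      fix c d assume "c \<in> Inn G" "d \<in> Inn G"
      then obtain g k where gk: "g \<in> carrier G" "k \<in> carrier G"
        and cd: "c = (\<lambda>x\<in>carrier G. g \<otimes> x \<otimes> inv g)" "d = (\<lambda>x\<in>carrier G. k \<otimes> x \<otimes> inv k)"
        by (auto simp: Inn_def)
      show "c \<otimes>\<^bsub>AutoGroup G\<^esub> d \<in> Inn G"
        unfolding cd AutoGroup_simps(2)[OF in_auto[OF gk(1)] in_auto[OF gk(2)]] Inn_mult[OF gk]
        using gk by (intro in_Inn) simp
    qed
  next
    fix \<alpha> c assume "\<alpha> \<in> carrier (AutoGroup G)" "c \<in> Inn G"
    then obtain g where \<alpha>: "\<alpha> \<in> auto G" and g: "g \<in> carrier G" and c: "c = (\<lambda>x\<in>carrier G. g \<otimes> x \<otimes> inv g)"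
      by (auto simp: Inn_def AutoGroup_simps)
    interpret \<alpha>: group_hom G G \<alpha>
      using autoD(1)[OF \<alpha>] by (simp add: group_hom_def group_hom_axioms_def is_group)
    \<comment> \<open>Conjugation by \<open>\<alpha>\<close> turns the inner automorphism of
      \<open>g\<close> into that of \<open>\<alpha> g\<close>. Comparing the two products with
      \<open>\<alpha>\<close> avoids evaluating the inverse of \<open>\<alpha>\<close>.\<close>
    define d where "d = (\<lambda>x\<in>carrier G. \<alpha> g \<otimes> x \<otimes> inv (\<alpha> g))"
    have d: "d \<in> Inn G" unfolding d_def using g by (intro in_Inn) simp
    have "compose (carrier G) \<alpha> c = compose (carrier G) d \<alpha>"
      using g by (auto simp: compose_def c d_def)
    then have "\<alpha> \<otimes>\<^bsub>AutoGroup G\<^esub> c = d \<otimes>\<^bsub>AutoGroup G\<^esub> \<alpha>"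
      using \<alpha> d in_auto[OF g] Inn_subset_auto by (auto simp: AutoGroup_simps c)
    moreover have "\<alpha> \<in> carrier (AutoGroup G)" "d \<in> carrier (AutoGroup G)"
      using \<alpha> d Inn_subset_auto by (auto simp: AutoGroup_simps)
    ultimately have "\<alpha> \<otimes>\<^bsub>AutoGroup G\<^esub> c \<otimes>\<^bsub>AutoGroup G\<^esub> inv\<^bsub>AutoGroup G\<^esub> \<alpha> = d"
      by (simp add: A.m_assoc)
    then show "\<alpha> \<otimes>\<^bsub>AutoGroup G\<^esub> c \<otimes>\<^bsub>AutoGroup G\<^esub> inv\<^bsub>AutoGroup G\<^esub> \<alpha> \<in> Inn G" using d by simp
  qed
qed

text \<open>The quotient map is surjective, so pulling back along it leaves the image unchanged, and
  the claims about Out(F_n) concern images only.\<close>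

lemma hom_Out_lift:
  assumes "h \<in> hom (Out G) K"
  obtains h' where "h' \<in> hom (Aut G) K" "h' ` carrier (Aut G) = h ` carrier (Out G)"
proof (rule that)
  let ?q = "\<lambda>\<alpha>. Inn G #>\<^bsub>AutoGroup G\<^esub> \<alpha>"
  show "h \<circ> ?q \<in> hom (Aut G) K"
    using Group.hom_compose[OF normal.r_coset_hom_Mod[OF Inn_normal]] assms by (simp add: Aut_def Out_def)
  show "(h \<circ> ?q) ` carrier (Aut G) = h ` carrier (Out G)"
    by (simp add: Aut_def Out_def carrier_FactGroup image_comp)
qed

end

subsection \<open>Automorphisms of free groups\<close>

lemma inv_free_group: "x \<in> carrier (free_group n) \<Longrightarrow> inv\<^bsub>free_group n\<^esub> x = winv x"
  by (intro group.inv_equality[OF group_free_group])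
    (simp_all add: winv_closed, simp add: fmul_winv_left carrier_free_group)

lemma letter_closed [simp]: "[a] \<in> carrier (free_group n) \<longleftrightarrow> snd a < n"
  by (simp add: carrier_free_group)

lemma Cons_closedD:
  assumes "a # w \<in> carrier (free_group n)"
  shows "snd a < n" "w \<in> carrier (free_group n)" "fmul [a] w = a # w"
proof -
  have red: "fg_reduced (a # w)" using assms by (simp add: carrier_free_group)
  show "snd a < n" "w \<in> carrier (free_group n)"
    using assms red by (simp_all add: carrier_free_group fg_reduced_Cons)
  show "fmul [a] w = a # w" using fmul_append[of "[a]" w] red by simp
qed

lemma hom_eq_word_ext:
  assumes "\<alpha> \<in> hom (free_group n) (free_group n)" "w \<in> carrier (free_group n)"
  shows "\<alpha> w = word_ext (\<lambda>a. \<alpha> [a]) w"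
  using assms(2)
proof (induction w)
  case Nil
  show ?case
    using hom_one[OF assms(1) group_free_group group_free_group] by simp
next
  case (Cons a w)
  then show ?case
    using Cons_closedD[OF Cons.prems] hom_mult[OF assms(1), of "[a]" w] by simp
qed

lemma letter_map_hom:
  assumes "\<alpha> \<in> hom (free_group n) (free_group n)"
  shows "letter_map n (\<lambda>a. \<alpha> [a])"
  unfolding letter_map_def
proof (intro allI impI conjI)
  interpret group_hom "free_group n" "free_group n" \<alpha>
    using assms group_free_group by (simp add: group_hom_def group_hom_axioms_def)
  fix a :: "bool \<times> nat" assume a: "snd a < n"
  then show "\<alpha> [a] \<in> carrier (free_group n)" by simp
  have "\<alpha> (inv\<^bsub>free_group n\<^esub> [a]) = inv\<^bsub>free_group n\<^esub> (\<alpha> [a])"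
    using a by (intro hom_inv) simp
  then show "\<alpha> [linv a] = winv (\<alpha> [a])"
    using a by (simp add: inv_free_group)
qed

definition free_end :: "nat \<Rightarrow> (bool \<times> nat \<Rightarrow> (bool \<times> nat) list) \<Rightarrow> (bool \<times> nat) list \<Rightarrow> (bool \<times> nat) list" where
  "free_end n f = (\<lambda>w\<in>carrier (free_group n). word_ext f w)"

lemma word_ext_letter: "letter_map n f \<Longrightarrow> snd a < n \<Longrightarrow> word_ext f [a] = f a"
  using letter_mapD[of n f a] by (simp add: fmul_Nil_right carrier_free_group)

lemma free_end_letter: "letter_map n f \<Longrightarrow> snd a < n \<Longrightarrow> free_end n f [a] = f a"
  using word_ext_letter unfolding free_end_def by simp

lemma free_end_hom: "letter_map n f \<Longrightarrow> free_end n f \<in> hom (free_group n) (free_group n)"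
proof (rule homI)
  fix x y assume f: "letter_map n f" and xy: "x \<in> carrier (free_group n)" "y \<in> carrier (free_group n)"
  then show "free_end n f (x \<otimes>\<^bsub>free_group n\<^esub> y) = free_end n f x \<otimes>\<^bsub>free_group n\<^esub> free_end n f y"
    by (simp add: free_end_def fmul_closed word_ext_fmul[OF f] snd_less_of_mem)
qed (simp add: free_end_def word_ext_closed snd_less_of_mem)

lemma hom_ext_letters:
  assumes "\<alpha> \<in> hom (free_group n) (free_group n)" "\<beta> \<in> hom (free_group n) (free_group n)"
    and "\<And>a. snd a < n \<Longrightarrow> \<alpha> [a] = \<beta> [a]" "w \<in> carrier (free_group n)"
  shows "\<alpha> w = \<beta> w"
proof -
  have "word_ext (\<lambda>a. \<alpha> [a]) w = word_ext (\<lambda>a. \<beta> [a]) w"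
    using assms(4)
  proof (induction w)
    case (Cons a w)
    then show ?case using Cons_closedD(1,2)[OF Cons.prems] assms(3)[of a] by simp
  qed simp
  then show ?thesis using hom_eq_word_ext assms by metis
qed

lemma auto_ext_letters:
  assumes "\<alpha> \<in> auto (free_group n)" "\<beta> \<in> auto (free_group n)"
    and "\<And>a. snd a < n \<Longrightarrow> \<alpha> [a] = \<beta> [a]"
  shows "\<alpha> = \<beta>"
proof (rule extensionalityI)
  show "\<alpha> \<in> extensional (carrier (free_group n))" "\<beta> \<in> extensional (carrier (free_group n))"
    using assms by (auto simp: auto_def Bij_def)
  show "\<alpha> w = \<beta> w" if "w \<in> carrier (free_group n)" for w
    using hom_ext_letters[of \<alpha> n \<beta> w] assms that by (auto simp: auto_def)
qed

lemma free_end_auto: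
  assumes f: "letter_map n f" and g: "letter_map n g"
    and fg: "\<And>a. snd a < n \<Longrightarrow> word_ext f (g a) = [a]" "\<And>a. snd a < n \<Longrightarrow> word_ext g (f a) = [a]"
  shows "free_end n f \<in> auto (free_group n)"
proof -
  have inverse: "free_end n f (free_end n g w) = w"
    if f: "letter_map n f" and g: "letter_map n g" and w: "w \<in> carrier (free_group n)"
      and fg: "\<And>a. snd a < n \<Longrightarrow> word_ext f (g a) = [a]" for f g w
  proof -
    have "(free_end n f \<circ> free_end n g) w = id w"
    proof (rule hom_ext_letters[OF _ _ _ w])
      show "free_end n f \<circ> free_end n g \<in> hom (free_group n) (free_group n)"
        by (rule hom_compose[OF free_end_hom[OF g] free_end_hom[OF f]])
      show "id \<in> hom (free_group n) (free_group n)" by (simp add: hom_def)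
      show "(free_end n f \<circ> free_end n g) [a] = id [a]" if "snd a < n" for a
        using that fg[OF that] letter_mapD(1)[OF g that] free_end_letter[OF g that]
        by (simp add: free_end_def)
    qed
    then show ?thesis by simp
  qed
  have "bij_betw (free_end n f) (carrier (free_group n)) (carrier (free_group n))"
    by (rule bij_betwI[of _ _ _ "free_end n g"])
      (use free_end_hom[OF f] free_end_hom[OF g] inverse f g fg in \<open>auto simp: hom_def\<close>)
  then show ?thesis using free_end_hom[OF f] by (simp add: auto_def Bij_def free_end_def)
qed

text \<open>For an inverse letter \<open>a = linv x\<close> this is the left multiplication of
  \<open>x\<close> by \<open>linv b\<close>, so one definition covers the left and the right Nielsen
  moves.\<close>

definition transv :: "bool \<times> nat \<Rightarrow> bool \<times> nat \<Rightarrow> bool \<times> nat \<Rightarrow> (bool \<times> nat) list" where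
  "transv a b c = (if c = a then [a, b] else if c = linv a then [linv b, linv a] else [c])"

lemma linv_eq_linv_iff: "linv a = b \<longleftrightarrow> a = linv b"
  by auto

lemma letter_map_transv:
  assumes "snd a < n" "snd b < n" "snd a \<noteq> snd b"
  shows "letter_map n (transv a b)"
  using assms unfolding letter_map_def carrier_free_group transv_def
  by (auto simp: snd_eq_iff_linv linv_eq_linv_iff)

lemma transv_auto:
  assumes "snd a < n" "snd b < n" "snd a \<noteq> snd b"
  shows "free_end n (transv a b) \<in> auto (free_group n)"
proof (rule free_end_auto[where g = "transv a (linv b)"])
  show "letter_map n (transv a b)" "letter_map n (transv a (linv b))"
    using letter_map_transv[of a n b] letter_map_transv[of a n "linv b"] assms by auto
qed (use assms in \<open>auto simp: transv_def snd_eq_iff_linv linv_eq_linv_iff\<close>)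

text \<open>Signed permutations of order at most two are enough: swaps, inversions and double swaps.
  The induced automorphism is its own inverse, so conjugation needs no inverse.\<close>

definition letter_inv :: "nat \<Rightarrow> (bool \<times> nat \<Rightarrow> bool \<times> nat) \<Rightarrow> bool" where
  "letter_inv n p \<longleftrightarrow> (\<forall>a. snd a < n \<longrightarrow> snd (p a) < n \<and> p (linv a) = linv (p a) \<and> p (p a) = a)"

lemma letter_invD:
  assumes "letter_inv n p" "snd a < n"
  shows "snd (p a) < n" "p (linv a) = linv (p a)" "p (p a) = a"
  using assms unfolding letter_inv_def by blast+

abbreviation letter_aut :: "nat \<Rightarrow> (bool \<times> nat \<Rightarrow> bool \<times> nat) \<Rightarrow> (bool \<times> nat) list \<Rightarrow> (bool \<times> nat) list" where
  "letter_aut n p \<equiv> free_end n (\<lambda>a. [p a])"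

lemma letter_map_letter_inv: "letter_inv n p \<Longrightarrow> letter_map n (\<lambda>a. [p a])"
  using letter_invD[of n p] unfolding letter_map_def by simp

lemma letter_aut_auto: "letter_inv n p \<Longrightarrow> letter_aut n p \<in> auto (free_group n)"
  using letter_invD[of n p]
  by (intro free_end_auto[where g = "\<lambda>a. [p a]"]) (simp_all add: letter_map_letter_inv)

definition swap_letters :: "nat \<Rightarrow> nat \<Rightarrow> bool \<times> nat \<Rightarrow> bool \<times> nat" where
  "swap_letters i j a = (fst a, Transposition.transpose i j (snd a))"

definition flip_letter :: "nat \<Rightarrow> bool \<times> nat \<Rightarrow> bool \<times> nat" where
  "flip_letter i a = (if snd a = i then linv a else a)"

lemma letter_inv_swap: "i < n \<Longrightarrow> j < n \<Longrightarrow> letter_inv n (swap_letters i j)"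
  by (auto simp: letter_inv_def swap_letters_def linv_def Transposition.transpose_def)

lemma letter_inv_flip: "letter_inv n (flip_letter i)"
  by (auto simp: letter_inv_def flip_letter_def)

lemma letter_inv_double_swap:
  assumes "distinct [i, j, k, l]" "{i, j, k, l} \<subseteq> {..<n}"
  shows "letter_inv n (swap_letters i j \<circ> swap_letters k l)"
  using assms by (auto simp: letter_inv_def swap_letters_def linv_def Transposition.transpose_def)

section \<open>Relations among the images of transvections and signed permutations\<close>

locale aut_free_hom = H: group H for H (structure) +
  fixes n h
  assumes h: "h \<in> hom (Aut (free_group n)) H"
begin

abbreviation "F \<equiv> carrier (free_group n)"
abbreviation "AF \<equiv> auto (free_group n)"

lemma group_Aut: "group (Aut (free_group n))"
  unfolding Aut_def by (rule group.AutoGroup[OF group_free_group])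

lemma Aut_simps:
  "carrier (Aut (free_group n)) = AF"
  "\<alpha> \<in> AF \<Longrightarrow> \<beta> \<in> AF \<Longrightarrow> \<alpha> \<otimes>\<^bsub>Aut (free_group n)\<^esub> \<beta> = compose F \<alpha> \<beta>"
  "\<one>\<^bsub>Aut (free_group n)\<^esub> = (\<lambda>w\<in>F. w)"
  by (auto simp: Aut_def AutoGroup_def BijGroup_def auto_def)

lemma h_closed [simp]: "\<alpha> \<in> AF \<Longrightarrow> h \<alpha> \<in> carrier H"
  using h Aut_simps(1) by (auto simp: hom_def)

lemma compose_AF: "\<alpha> \<in> AF \<Longrightarrow> \<beta> \<in> AF \<Longrightarrow> compose F \<alpha> \<beta> \<in> AF"
  using group.is_monoid[OF group_Aut, THEN monoid.m_closed, of \<alpha> \<beta>] Aut_simps by simp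

lemma h_compose: "\<alpha> \<in> AF \<Longrightarrow> \<beta> \<in> AF \<Longrightarrow> h (compose F \<alpha> \<beta>) = h \<alpha> \<otimes> h \<beta>"
  using hom_mult[OF h, of \<alpha> \<beta>] Aut_simps by simp

lemma id_AF: "(\<lambda>w\<in>F. w) \<in> AF"
  using group.id_in_auto[OF group_free_group] .

lemma h_id: "h (\<lambda>w\<in>F. w) = \<one>"
  using hom_one[OF h group_Aut H.group_axioms] Aut_simps by simp

lemma compose_eqI:
  assumes "\<alpha> \<in> AF" "\<beta> \<in> AF" "\<gamma> \<in> AF" "\<And>a. snd a < n \<Longrightarrow> \<alpha> (\<beta> [a]) = \<gamma> [a]"
  shows "compose F \<alpha> \<beta> = \<gamma>"
  by (rule auto_ext_letters[OF compose_AF]) (use assms in \<open>auto simp: compose_def\<close>)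

lemma letter_aut_involution:
  assumes "letter_inv n p"
  shows "h (letter_aut n p) \<otimes> h (letter_aut n p) = \<one>"
proof -
  note A = letter_aut_auto[OF assms]
  have "compose F (letter_aut n p) (letter_aut n p) = (\<lambda>w\<in>F. w)"
    using letter_invD[OF assms] letter_map_letter_inv[OF assms]
    by (intro compose_eqI A id_AF) (simp add: free_end_letter)
  then show ?thesis using h_compose[OF A A] h_id by simp
qed

lemma free_end_word:
  "letter_map n f \<Longrightarrow> w \<in> F \<Longrightarrow> free_end n f w = word_ext f w"
  by (simp add: free_end_def)

text \<open>Signed permutations act on transvections by relabelling; \<open>p\<close> stands on both
  sides because it is an involution.\<close>

lemma conj_transv:
  assumes p: "letter_inv n p" and ab: "snd a < n" "snd b < n" "snd a \<noteq> snd b" "snd (p a) \<noteq> snd (p b)"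
  shows "h (free_end n (transv (p a) (p b))) = 
           h (letter_aut n p) \<otimes> h (free_end n (transv a b)) \<otimes> h (letter_aut n p)"
proof -
  note P = letter_aut_auto[OF p] and T = transv_auto[OF ab(1-3)]
  note pa = letter_invD[OF p ab(1)] and pb = letter_invD[OF p ab(2)]
  have "compose F (compose F (letter_aut n p) (free_end n (transv a b))) (letter_aut n p) =
          free_end n (transv (p a) (p b))"
  proof (intro compose_eqI compose_AF P T transv_auto pa(1) pb(1) ab(4))
    fix c :: "bool \<times> nat" assume c: "snd c < n"
    note pc = letter_invD[OF p c]
    have "transv (p a) (p b) c = map p (transv a b (p c))"
      using pa pb pc ab(3) letter_invD(2)[OF p pa(1)] by (auto simp: transv_def)
    moreover have "word_ext (\<lambda>a. [p a]) (transv a b (p c)) = map p (transv a b (p c))"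
      using pa pb pc ab(3,4) by (auto simp: transv_def snd_eq_iff_linv)
    moreover have "transv a b (p c) \<in> F"
      using letter_mapD(1)[OF letter_map_transv[OF ab(1-3)] pc(1)] .
    ultimately show "compose F (letter_aut n p) (free_end n (transv a b)) (letter_aut n p [c]) = 
        free_end n (transv (p a) (p b)) [c]"
      using c pc(1) letter_map_letter_inv[OF p] letter_map_transv[OF ab(1-3)]
        letter_map_transv[OF pa(1) pb(1) ab(4)]
      by (simp add: free_end_letter compose_def free_end_word)
  qed
  then show ?thesis using h_compose P T compose_AF by metis
qed

lemma conj_letter_aut:
  assumes p: "letter_inv n p" and q: "letter_inv n q" and r: "letter_inv n r"
    and pqr: "\<And>a. snd a < n \<Longrightarrow> p (q (p a)) = r a"
  shows "h (letter_aut n r) = h (letter_aut n p) \<otimes> h (letter_aut n q) \<otimes> h (letter_aut n p)"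
proof -
  note P = letter_aut_auto[OF p] and Q = letter_aut_auto[OF q] and R = letter_aut_auto[OF r]
  have "compose F (compose F (letter_aut n p) (letter_aut n q)) (letter_aut n p) = letter_aut n r"
    using letter_invD(1)[OF p] letter_invD(1)[OF q] pqr
    by (intro compose_eqI compose_AF P Q R)
      (simp add: free_end_letter letter_map_letter_inv p q r compose_def)
  then show ?thesis using h_compose P Q compose_AF by metis
qed

text \<open>The relation behind the collapse: \<open>[x\<^sub>j \<mapsto> x\<^sub>j x\<^sub>k]\<close> and \<open>[x\<^sub>i \<mapsto> x\<^sub>i x\<^sub>j]\<close> commute up to \<open>[x\<^sub>i \<mapsto> x\<^sub>i x\<^sub>k]\<close>.\<close>

lemma transv_relation:
  assumes "snd a < n" "snd b < n" "snd c < n" "distinct [snd a, snd b, snd c]"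
  shows "h (free_end n (transv b c)) \<otimes> h (free_end n (transv a b)) =
    h (free_end n (transv a b)) \<otimes> h (free_end n (transv b c)) \<otimes> h (free_end n (transv a c))"
proof -
  have T: "free_end n (transv a b) \<in> AF" "free_end n (transv b c) \<in> AF" "free_end n (transv a c) \<in> AF"
    using assms by (auto intro!: transv_auto)
  have L: "letter_map n (transv a b)" "letter_map n (transv b c)" "letter_map n (transv a c)"
    using assms by (auto intro!: letter_map_transv)
  have "compose F (free_end n (transv b c)) (free_end n (transv a b)) =
        compose F (compose F (free_end n (transv a b)) (free_end n (transv b c))) (free_end n (transv a c))"
  proof (intro compose_eqI compose_AF T)
    fix d :: "bool \<times> nat" assume d: "snd d < n"
    have "word_ext (transv b c) (transv a b d) = word_ext (transv a b) (word_ext (transv b c) (transv a c d))"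
      using assms by (auto simp: transv_def snd_eq_iff_linv linv_eq_linv_iff)
    then show "free_end n (transv b c) (free_end n (transv a b) [d]) =
      compose F (compose F (free_end n (transv a b)) (free_end n (transv b c))) (free_end n (transv a c)) [d]"
      using d letter_mapD(1)[OF L(1) d] letter_mapD(1)[OF L(3) d] 
        word_ext_closed[OF L(2), of "transv a c d"]
      by (simp add: free_end_letter L compose_def free_end_word snd_less_of_mem)
  qed
  then show ?thesis using h_compose T compose_AF by metis
qed

end

section \<open>Collapse of the image to at most two elements\<close>

lemma ex_fresh_less: "length xs < n \<Longrightarrow> \<exists>k<n. k \<notin> set xs" for n :: nat
  by (metis List.finite_set card_length card_lessThan card_mono lessThan_iff order.strict_trans1
      linorder_not_less subsetI)

text \<open>The vanishing of double transpositions is all that the geometry has to supply here; the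
  consequences drawn from it are algebra in \<open>H\<close> and serve both the circle and the
  interval.\<close>

locale nielsen_collapse = aut_free_hom +
  assumes n: "6 \<le> n"
    and double_swap: "\<And>i j k l. distinct [i, j, k, l] \<Longrightarrow> {i, j, k, l} \<subseteq> {..<n} \<Longrightarrow>
      h (letter_aut n (swap_letters i j \<circ> swap_letters k l)) = \<one>"
begin

text \<open>Double transpositions act 2-transitively on the indices, so \<open>h\<close> takes a single value \<open>u\<close> on the
  positive transvections, and the relation above becomes \<open>u u = u u u\<close>.\<close>

lemma positive_transv_trivial:
  assumes ij: "i < n" "j < n" "i \<noteq> j"
  shows "h (free_end n (transv (True, i) (True, j))) = \<one>"
proof -
  define T where "T i j = h (free_end n (transv (True, i) (True, j)))" for i j
  have T_closed: "T i j \<in> carrier H" if "i < n" "j < n" "i \<noteq> j" for i j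
    unfolding T_def using that by (intro h_closed transv_auto) auto
  obtain k where k: "k < n" "k \<notin> {i, j}"
    using ex_fresh_less[of "[i, j]" n] n by auto
  obtain p where p: "p < n" "p \<notin> {i, j, k}"
    using ex_fresh_less[of "[i, j, k]" n] n by auto
  obtain q where q: "q < n" "q \<notin> {i, j, k, p}"
    using ex_fresh_less[of "[i, j, k, p]" n] n by auto
  \<comment> \<open>The spare swap of \<open>p\<close> and \<open>q\<close> completes the swap of
    \<open>r\<close> and \<open>s\<close> to a double transposition. It misses both indices of the
    transvection, so only the first swap relabels it.\<close>
  have move: "T (Transposition.transpose r s i') (Transposition.transpose r s j') = T i' j'"
    if "distinct [r, s, p, q]" "r < n" "s < n" "i' < n" "j' < n" "distinct [i', j', p, q]" for r s i' j'
  proof -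
    let ?p = "swap_letters r s \<circ> swap_letters p q"
    have inv: "letter_inv n ?p"
      using that p q by (intro letter_inv_double_swap) auto
    have "Transposition.transpose p q i' = i'" "Transposition.transpose p q j' = j'"
      using that by auto
    then have pi: "?p (True, i') = (True, Transposition.transpose r s i')"
      "?p (True, j') = (True, Transposition.transpose r s j')"
      by (simp_all add: swap_letters_def)
    have "h (letter_aut n ?p) = \<one>"
      using that p q by (intro double_swap) auto
    moreover have "snd (?p (True, i')) \<noteq> snd (?p (True, j'))"
      unfolding pi using that by (auto dest: transpose_eq_imp_eq)
    ultimately show ?thesis
      using conj_transv[OF inv, of "(True, i')" "(True, j')"] that T_closed[of i' j']
      unfolding pi by (simp add: T_def)
  qed
  have "T i k = T i j" using move[of j k i j] ij k p q by auto
  moreover have "T j k = T i k" using move[of i j i k] ij k p q by auto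
  moreover have "T j k \<otimes> T i j = T i j \<otimes> T j k \<otimes> T i k"
    unfolding T_def using ij k by (intro transv_relation) auto
  ultimately have "T i j \<otimes> T i j \<otimes> T i j = T i j \<otimes> T i j" by simp
  then have "T i j = \<one>" using T_closed[OF ij] by simp
  then show ?thesis by (simp add: T_def)
qed

text \<open>Conjugation by the inversion of one generator changes the sign of one letter, so all
  sign patterns follow from the positive one.\<close>

lemma transv_trivial:
  assumes "snd a < n" "snd b < n" "snd a \<noteq> snd b"
  shows "h (free_end n (transv a b)) = \<one>"
proof -
  have flip: "h (free_end n (transv (flip_letter i a) (flip_letter i b))) = \<one>"
    if ab: "snd a < n" "snd b < n" "snd a \<noteq> snd b" and 1: "h (free_end n (transv a b)) = \<one>" for i a b
    using conj_transv[OF letter_inv_flip ab, of i] ab letter_aut_involution[OF letter_inv_flip, of i]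
      h_closed[OF letter_aut_auto[OF letter_inv_flip], of i]
    by (simp add: 1 flip_letter_def split: if_splits)
  have "h (free_end n (transv (fst a, snd a) (True, snd b))) = \<one>"
    using positive_transv_trivial[OF assms] flip[of "(True, snd a)" "(True, snd b)" "snd a"] assms
    by (cases "fst a") (auto simp: flip_letter_def linv_def)
  then have "h (free_end n (transv a (fst b, snd b))) = \<one>"
    using flip[of a "(True, snd b)" "snd b"] assms
    by (cases "fst b") (auto simp: flip_letter_def linv_def)
  then show ?thesis by simp
qed

text \<open>Lift to the free group of the factorization of a quarter turn in SL_2(Z) into three
  elementary matrices: inversion of \<open>x_j\<close> followed by the swap is a product of three
  transvections, one of them a left multiplication. Their images vanish, and an involution equals
  its inverse.\<close>

lemma swap_eq_flip:
  assumes ij: "i < n" "j < n" "i \<noteq> j"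
  shows "h (letter_aut n (swap_letters i j)) = h (letter_aut n (flip_letter j))"
proof -
  let ?x = "(True, i)" and ?y = "(True, j)"
  have S: "letter_aut n (swap_letters i j) \<in> AF" "letter_aut n (flip_letter j) \<in> AF"
    using ij by (auto intro!: letter_aut_auto letter_inv_swap letter_inv_flip)
  have T: "free_end n (transv ?x ?y) \<in> AF" "free_end n (transv ?y (linv ?x)) \<in> AF"
      "free_end n (transv (linv ?x) (linv ?y)) \<in> AF"
    using ij by (auto intro!: transv_auto)
  have L: "letter_map n (transv ?x ?y)" "letter_map n (transv ?y (linv ?x))" 
      "letter_map n (transv (linv ?x) (linv ?y))"
    using ij by (auto intro!: letter_map_transv)
  have L': "letter_map n (\<lambda>a. [swap_letters i j a])" "letter_map n (\<lambda>a. [flip_letter j a])"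
    using ij by (auto intro!: letter_map_letter_inv letter_inv_swap letter_inv_flip)
  have "compose F (letter_aut n (swap_letters i j)) (letter_aut n (flip_letter j)) =
        compose F (compose F (free_end n (transv ?x ?y)) (free_end n (transv ?y (linv ?x)))) 
          (free_end n (transv (linv ?x) (linv ?y)))"
  proof (intro compose_eqI compose_AF T S)
    fix d :: "bool \<times> nat" assume d: "snd d < n"
    have "[swap_letters i j (flip_letter j d)] = 
        word_ext (transv ?x ?y) (word_ext (transv ?y (linv ?x)) (transv (linv ?x) (linv ?y) d))"
      using ij by (cases d) (auto simp: transv_def linv_def swap_letters_def flip_letter_def Transposition.transpose_def)
    moreover have "snd (flip_letter j d) < n" using d by (simp add: flip_letter_def)
    ultimately show "letter_aut n (swap_letters i j) (letter_aut n (flip_letter j) [d]) =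
      compose F (compose F (free_end n (transv ?x ?y)) (free_end n (transv ?y (linv ?x)))) 
          (free_end n (transv (linv ?x) (linv ?y))) [d]"
      using d letter_mapD(1)[OF L(3) d] word_ext_closed[OF L(2), of "transv (linv ?x) (linv ?y) d"]
      by (simp add: free_end_letter L L' compose_def free_end_word snd_less_of_mem)
  qed
  then have "h (letter_aut n (swap_letters i j)) \<otimes> h (letter_aut n (flip_letter j)) = 
      h (free_end n (transv ?x ?y)) \<otimes> h (free_end n (transv ?y (linv ?x))) \<otimes>
      h (free_end n (transv (linv ?x) (linv ?y)))"
    using h_compose S T compose_AF by metis
  also have "\<dots> = \<one>" using ij by (simp add: transv_trivial)
  finally show ?thesis
    using letter_aut_involution[OF letter_inv_flip, of j] S h_closed H.r_cancel by metis
qed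

definition "e = h (letter_aut n (flip_letter 0))"

lemma e_closed [simp]: "e \<in> carrier H" and e_involution [simp]: "e \<otimes> e = \<one>"
  unfolding e_def using letter_aut_involution[OF letter_inv_flip] letter_aut_auto[OF letter_inv_flip]
  by auto

lemma sign_cancel:
  assumes "x \<in> {\<one>, e}" "y \<in> carrier H" "x \<otimes> y \<in> {\<one>, e}"
  shows "y \<in> {\<one>, e}"
proof (cases "x = \<one>")
  case False
  then have "y = e \<otimes> (x \<otimes> y)" using assms H.m_assoc[of e e y] by simp
  then show ?thesis using assms(3) by auto
qed (use assms in simp)

text \<open>A swap does not remember the order of its indices, so \<open>swap_eq_flip\<close> read
  both ways identifies the two inversions.\<close>

lemma flip_eq:
  assumes "i < n"
  shows "h (letter_aut n (flip_letter i)) = e"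
proof (cases "i = 0")
  case False
  have "swap_letters i 0 = swap_letters 0 i"
    by (auto simp: swap_letters_def fun_eq_iff transpose_commute)
  then show ?thesis
    using swap_eq_flip[of i 0] swap_eq_flip[of 0 i] assms n False by (simp add: e_def)
qed (simp add: e_def)

text \<open>Sorting by induction on the number of generators not yet known to be fixed: one swap and
  possibly one inversion restore generator \<open>k\<close>, and both have values in
  \<open>{\<one>, e}\<close>.\<close>

lemma letter_permutation_image:
  assumes "\<alpha> \<in> AF" "\<And>a. snd a < n \<Longrightarrow> \<exists>c. \<alpha> [a] = [c]"
    and "\<And>a. k \<le> snd a \<Longrightarrow> snd a < n \<Longrightarrow> \<alpha> [a] = [a]" "k \<le> n"
  shows "h \<alpha> \<in> {\<one>, e}"
  using assms
proof (induction k arbitrary: \<alpha>)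
  case 0
  then have "\<alpha> = (\<lambda>w\<in>F. w)" by (intro auto_ext_letters[OF _ id_AF]) auto
  then have "h \<alpha> = \<one>" using h_id by (simp only:)
  then show ?case by simp
next
  case (Suc k)
  note \<alpha> = Suc.prems(1)
  note hom = autoD(1)[OF \<alpha>] and inj = autoD(2)[OF \<alpha>]
  obtain c where c: "\<alpha> [(True, k)] = [c]" using Suc.prems(2)[of "(True, k)"] Suc.prems(4) by auto
  have "[c] \<in> F" using hom c Suc.prems(4) by (auto simp: hom_def Pi_def dest: spec[of _ "[(True, k)]"])
  then have cn: "snd c < n" by simp
  \<comment> \<open>Injectivity keeps the image of generator \<open>k\<close> away from the
    generators already fixed, so the swap below does not disturb them.\<close>
  have ck: "snd c \<le> k"
  proof (rule ccontr)
    assume "\<not> ?thesis"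
    then have "\<alpha> [c] = \<alpha> [(True, k)]" using c Suc.prems(3)[of c] cn by simp
    then have "[c] = [(True, k)]" using inj cn Suc.prems(4) by (auto dest!: inj_onD)
    then show False using \<open>\<not> snd c \<le> k\<close> by simp
  qed
  define p where "p = swap_letters k (snd c)"
  define q where "q = (if fst c then (\<lambda>a. a) else flip_letter k)"
  have p: "letter_inv n p" using Suc.prems(4) cn by (auto simp: p_def intro: letter_inv_swap)
  have q: "letter_inv n q" using letter_inv_flip by (auto simp: q_def letter_inv_def)
  note P = letter_aut_auto[OF p] and Q = letter_aut_auto[OF q]
  have id1: "h (letter_aut n (\<lambda>a. a)) = \<one>"
  proof -
    have "letter_inv n (\<lambda>a. a)" by (simp add: letter_inv_def)
    then have "letter_aut n (\<lambda>a. a) = (\<lambda>w\<in>F. w)"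
      by (intro auto_ext_letters[OF _ id_AF] letter_aut_auto) (simp_all add: free_end_letter letter_map_letter_inv)
    then show ?thesis using h_id by (simp only:)
  qed
  have hp: "h (letter_aut n p) \<in> {\<one>, e}"
  proof (cases "snd c = k")
    case True
    then have "p = (\<lambda>a. a)" by (auto simp: p_def swap_letters_def fun_eq_iff)
    then show ?thesis using id1 by simp
  next
    case False
    then show ?thesis using swap_eq_flip[of k "snd c"] flip_eq[OF cn] cn Suc.prems(4) by (simp add: p_def)
  qed
  have hq: "h (letter_aut n q) \<in> {\<one>, e}"
    using id1 flip_eq[of k] Suc.prems(4) by (auto simp: q_def)
  define \<beta> where "\<beta> = compose F (letter_aut n q) (compose F (letter_aut n p) \<alpha>)"
  have \<beta>: "\<beta> \<in> AF" "h \<beta> = h (letter_aut n q) \<otimes> (h (letter_aut n p) \<otimes> h \<alpha>)"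
    using P Q \<alpha> by (simp_all add: \<beta>_def compose_AF h_compose)
  have \<beta>_letter: "\<beta> [a] = [q (p d)]" if "snd a < n" "\<alpha> [a] = [d]" for a d
  proof -
    have "[d] \<in> F" using hom that by (auto simp: hom_def Pi_def dest: spec[of _ "[a]"])
    then show ?thesis
      using that letter_invD(1)[OF p, of d] P Q
      by (simp add: \<beta>_def compose_def free_end_letter letter_map_letter_inv p q)
  qed
  have "h \<beta> \<in> {\<one>, e}"
  proof (rule Suc.IH[OF \<beta>(1)])
    show "\<exists>c. \<beta> [a] = [c]" if "snd a < n" for a
      using \<beta>_letter[OF that] Suc.prems(2)[OF that] by blast
    show "\<beta> [a] = [a]" if a: "k \<le> snd a" "snd a < n" for a
    proof (cases "snd a = k")
      case True
      have fix_k: "\<beta> [(True, k)] = [(True, k)]"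
        using \<beta>_letter[of "(True, k)" c] c Suc.prems(4) 
        by (auto simp: q_def p_def swap_letters_def flip_letter_def linv_def prod_eq_iff)
      have "letter_map n (\<lambda>a. \<beta> [a])"
        using \<beta>(1) by (intro letter_map_hom) (simp add: auto_def)
      then have "\<beta> [linv (True, k)] = winv [(True, k)]"
        using letter_mapD(2)[of n "\<lambda>a. \<beta> [a]" "(True, k)"] fix_k Suc.prems(4) by simp
      then show ?thesis using fix_k snd_eq_iff_linv[of a "(True, k)"] True by auto
    next
      case False
      then have "\<beta> [a] = [q (p a)]" using a Suc.prems(3)[of a] by (intro \<beta>_letter) auto
      then show ?thesis using a False ck 
        by (auto simp: p_def q_def swap_letters_def flip_letter_def Transposition.transpose_def)
    qed
  qed (use Suc.prems in simp)
  then have "h (letter_aut n q) \<otimes> (h (letter_aut n p) \<otimes> h \<alpha>) \<in> {\<one>, e}" using \<beta>(2) by simp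
  from sign_cancel[OF hp _ sign_cancel[OF hq _ this]] show ?case
    using \<alpha> P by simp
qed

text \<open>Precomposing with a reducing transvection changes the image of one generator only and
  leaves \<open>h \<alpha>\<close> unchanged, so a minimal \<open>\<alpha>\<close> decides the
  matter.\<close>

lemma image_le_two:
  assumes "\<alpha> \<in> AF"
  shows "h \<alpha> \<in> {\<one>, e}"
  using assms
proof (induction \<alpha> rule: wf_induct_rule[OF wf_measures[of
    "[\<lambda>\<alpha>. \<Sum>i<n. length (\<alpha> [(True, i)]), \<lambda>\<alpha>. \<Sum>i<n. half_rank n (\<alpha> [(True, i)])]"]])
  case (1 \<alpha>)
  note hom = autoD(1)[OF 1(2)] and inj = autoD(2)[OF 1(2)]
  note L = letter_map_hom[OF hom]
  show ?case
  proof (cases "\<exists>a b. snd a < n \<and> snd b < n \<and> snd a \<noteq> snd b \<and> shorter n (fmul (\<alpha> [a]) (\<alpha> [b])) (\<alpha> [a])")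
    case True
    then obtain a b where ab: "snd a < n" "snd b < n" "snd a \<noteq> snd b" 
      and less: "shorter n (fmul (\<alpha> [a]) (\<alpha> [b])) (\<alpha> [a])" by blast
    define \<beta> where "\<beta> = compose F \<alpha> (free_end n (transv a b))"
    note T = transv_auto[OF ab] and LT = letter_map_transv[OF ab]
    have \<beta>: "\<beta> \<in> AF" "h \<beta> = h \<alpha>"
      using 1(2) T transv_trivial[OF ab] by (simp_all add: \<beta>_def compose_AF h_compose)
    have L\<beta>: "letter_map n (\<lambda>a. \<beta> [a])" using \<beta>(1) by (intro letter_map_hom) (simp add: auto_def)
    have letter: "\<beta> [c] = \<alpha> (transv a b c)" if "snd c < n" for c
      using that by (simp add: \<beta>_def compose_def free_end_letter LT)
    have "[a, b] = fmul [a] [b]" using ab(3) by auto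
    then have \<beta>a: "\<beta> [a] = fmul (\<alpha> [a]) (\<alpha> [b])"
      using letter[OF ab(1)] hom_mult[OF hom, of "[a]" "[b]"] ab by (simp add: transv_def)
    \<comment> \<open>The measures sum over positive generators while \<open>a\<close> may be an
      inverse letter; both quantities are invariant under \<open>winv\<close>.\<close>
    have same: "length (\<gamma> [(True, snd a)]) = length (\<gamma> [a])" 
        "half_rank n (\<gamma> [(True, snd a)]) = half_rank n (\<gamma> [a])" if "letter_map n (\<lambda>a. \<gamma> [a])" for \<gamma>
      using letter_mapD(2)[OF that ab(1)] snd_eq_iff_linv[of "(True, snd a)" a] half_rank_winv
      by auto
    have other: "\<beta> [(True, i)] = \<alpha> [(True, i)]" if "i \<in> {..<n} - {snd a}" for i
    proof -
      have "(True, i) \<noteq> a" "(True, i) \<noteq> linv a" using that by (auto simp: linv_def)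
      then show ?thesis using letter[of "(True, i)"] that by (simp add: transv_def)
    qed
    have split: "(\<Sum>i<n. g (\<gamma> [(True, i)])) = g (\<gamma> [(True, snd a)]) + (\<Sum>i\<in>{..<n} - {snd a}. g (\<gamma> [(True, i)]))"
      for g :: "(bool \<times> nat) list \<Rightarrow> nat" and \<gamma>
      using ab(1) by (intro sum.remove) auto
    have "(\<beta>, \<alpha>) \<in> measures [\<lambda>\<alpha>. \<Sum>i<n. length (\<alpha> [(True, i)]), \<lambda>\<alpha>. \<Sum>i<n. half_rank n (\<alpha> [(True, i)])]"
      using less unfolding shorter_def
      by (auto simp: split[of length] split[of "half_rank n"] same[OF L\<beta>] same[OF L] \<beta>a other)
    then show ?thesis using 1(1)[of \<beta>] \<beta> by simp
  next
    case False
    have mono: "length y \<le> length (\<alpha> y)" if "y \<in> F" for y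
    proof -
      have "length y \<le> length (word_ext (\<lambda>a. \<alpha> [a]) y)"
      proof (rule nielsen_step[OF L _ _ that])
        fix a :: "bool \<times> nat" assume a: "snd a < n"
        have "\<alpha> [] = []"
          using hom_one[OF hom group_free_group group_free_group] by simp
        then show "\<alpha> [a] \<noteq> []"
          using inj_onD[OF inj, of "[a]" "[]"] a by (auto simp: carrier_free_group)
      qed (use False in blast)
      then show ?thesis using hom_eq_word_ext[OF hom that] by simp
    qed
    \<comment> \<open>The length bound controls preimages: \<open>\<beta> [a]\<close> is at most as
      long as its image \<open>[a]\<close> under \<open>\<alpha>\<close>. Hence
      \<open>\<beta>\<close>, rather than \<open>\<alpha>\<close>, is seen to send letters to
      letters.\<close>
    define \<beta> where "\<beta> = inv\<^bsub>Aut (free_group n)\<^esub> \<alpha>"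
    have \<beta>: "\<beta> \<in> AF" "compose F \<alpha> \<beta> = (\<lambda>w\<in>F. w)"
    proof -
      show b: "\<beta> \<in> AF" unfolding \<beta>_def using group.inv_closed[OF group_Aut, of \<alpha>] Aut_simps(1) 1(2) by simp
      show "compose F \<alpha> \<beta> = (\<lambda>w\<in>F. w)"
        using group.r_inv[OF group_Aut, of \<alpha>] Aut_simps(1,3) Aut_simps(2)[OF 1(2) b] 1(2) by (simp add: \<beta>_def)
    qed
    have inverse: "h \<alpha> \<otimes> h \<beta> = \<one>" using h_compose[OF 1(2) \<beta>(1)] \<beta>(2) h_id by simp
    have "h \<beta> \<in> {\<one>, e}"
    proof (rule letter_permutation_image[OF \<beta>(1), where k = n])
      fix a :: "bool \<times> nat" assume a: "snd a < n"
      have \<beta>a: "\<beta> [a] \<in> F" "\<alpha> (\<beta> [a]) = [a]"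
        using autoD(1)[OF \<beta>(1)] fun_cong[OF \<beta>(2), of "[a]"] a by (simp_all add: hom_def Pi_def compose_def)
      moreover have "\<beta> [a] \<noteq> []"
        using hom_one[OF hom group_free_group group_free_group] \<beta>a by auto
      ultimately show "\<exists>c. \<beta> [a] = [c]"
        using mono[of "\<beta> [a]"] by (cases "\<beta> [a]") auto
    qed auto
    then show ?thesis
      using sign_cancel[of "h \<beta>" "h \<alpha>"] H.inv_comm[OF inverse] 1(2) \<beta>(1) by simp
  qed
qed

end

subsection \<open>Involutions of the circle\<close>

text \<open>Applying \<open>C\<close> to an inequality between \<open>x\<close> and
  \<open>C x\<close> preserves its direction but exchanges its two sides.\<close>

lemma mono_involution_fixes:
  fixes C :: "'a :: linorder \<Rightarrow> 'a"
  assumes "mono_on S C" "x \<in> S" "C x \<in> S" "C (C x) = x"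
  shows "C x = x"
  using assms by (metis linorder_linear mono_onD order_antisym)

section \<open>Lifts of circle maps to the real line\<close>

lemma cis_eq_cis_iff: "cis x = cis y \<longleftrightarrow> (\<exists>k::int. x = y + 2 * pi * k)"
  using sin_cos_eq_iff[of x y] by (auto simp: complex_eq_iff)

lemma ball_sphere_iff_cis: "(\<forall>z\<in>sphere 0 1. P z) \<longleftrightarrow> (\<forall>t. P (cis t))"
proof
  assume *: "\<forall>t. P (cis t)"
  show "\<forall>z\<in>sphere 0 1. P z"
  proof
    fix z :: complex assume "z \<in> sphere 0 1"
    then have "z = cis (Arg z)" using rcis_cmod_Arg[of z] by (simp add: rcis_def)
    then show "P z" using * by metis
  qed
qed simp

text \<open>The difference of the lifts, measured in full turns, is continuous and integer-valued on
  the connected line.\<close>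

lemma cis_equal_lifts:
  fixes A B :: "real \<Rightarrow> real"
  assumes "continuous_on UNIV A" "continuous_on UNIV B" "\<And>t. cis (A t) = cis (B t)"
  obtains k :: int where "\<And>t. A t = B t + 2 * pi * k"
proof -
  define d where "d t = (A t - B t) / (2 * pi)" for t
  have d_int: "\<exists>k::int. d t = k" for t
    using assms(3)[of t] by (auto simp: cis_eq_cis_iff d_def)
  have "d constant_on UNIV"
  proof (rule continuous_discrete_range_constant)
    show "continuous_on UNIV d" unfolding d_def by (intro continuous_intros assms(1,2)) auto
    fix x
    show "\<exists>e>0. \<forall>y. y \<in> UNIV \<and> d y \<noteq> d x \<longrightarrow> e \<le> norm (d y - d x)"
    proof (intro exI[of _ 1] conjI allI impI)
      fix y assume *: "y \<in> UNIV \<and> d y \<noteq> d x"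
      obtain k l :: int where "d y = k" "d x = l" using d_int by metis
      then show "1 \<le> norm (d y - d x)" using * by (simp flip: of_int_diff of_int_abs)
    qed simp
  qed simp
  then obtain c where c: "\<And>t. d t = c" by (auto simp: constant_on_def)
  obtain k :: int where k: "d 0 = k" using d_int by blast
  show thesis
  proof (rule that[of k])
    show "A t = B t + 2 * pi * k" for t
      using c[of t] c[of 0] k by (simp add: d_def field_simps)
  qed
qed

definition circle_lift :: "(complex \<Rightarrow> complex) \<Rightarrow> (real \<Rightarrow> real) \<Rightarrow> bool" where
  "circle_lift f A \<longleftrightarrow> continuous_on UNIV A \<and> strict_mono A \<and> (\<forall>t. f (cis t) = cis (A t)) \<and>
     (\<forall>t. A (t + 2 * pi) = A t + 2 * pi)"

lemma circle_liftD:
  assumes "circle_lift f A"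
  shows "continuous_on UNIV A" "strict_mono A" "f (cis t) = cis (A t)" "A (t + 2 * pi) = A t + 2 * pi"
  using assms by (auto simp: circle_lift_def)

lemma circle_lift_int:
  assumes "circle_lift f A"
  shows "A (t + 2 * pi * of_int m) = A t + 2 * pi * of_int m"
proof (induction m rule: int_induct[where k = 0])
  case (step1 i)
  then show ?case using circle_liftD(4)[OF assms, of "t + 2 * pi * of_int i"] by (simp add: algebra_simps)
next
  case (step2 i)
  then show ?case using circle_liftD(4)[OF assms, of "t + 2 * pi * of_int (i - 1)"] by (simp add: algebra_simps)
qed simp

lemma circle_lift_shift:
  assumes "circle_lift f A"
  shows "circle_lift f (\<lambda>t. A t + 2 * pi * of_int m)"
proof -
  have "continuous_on UNIV (\<lambda>t. A t + 2 * pi * of_int m)"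
    by (intro continuous_intros circle_liftD(1)[OF assms])
  moreover have "cis (A t + 2 * pi * of_int m) = cis (A t)" for t
    by (auto simp: cis_eq_cis_iff)
  ultimately show ?thesis using assms by (auto simp: circle_lift_def strict_mono_def)
qed

text \<open>Near \<open>t\<close> the lift is \<open>A t\<close> plus the argument of
  \<open>c s / c t\<close>. This quotient is 1 at \<open>s = t\<close>, so the principal logarithm
  applies away from its cut. Since \<open>c t\<close> has norm 1, the resulting derivative
  \<open>Im (v / c t)\<close> is the tangential component of \<open>v\<close>, which is positive by
  assumption.\<close>

lemma vector_derivative_lift_pos:
  fixes A :: "real \<Rightarrow> real"
  assumes cont: "continuous_on UNIV A" and c: "\<And>t. c t = cis (A t)"
    and deriv: "(c has_vector_derivative v) (at t)" and pos: "Re (v * cnj (\<i> * c t)) > 0"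
  shows "\<exists>D>0. (A has_real_derivative D) (at t)"
proof -
  define q where "q = Ln \<circ> (\<lambda>s. c s / c t)"
  have nz: "c t \<noteq> 0" by (simp add: c)
  have "(q has_vector_derivative v / c t * inverse 1) (at t)"
    unfolding q_def
  proof (rule field_vector_diff_chain_at)
    show "((\<lambda>s. c s / c t) has_vector_derivative v / c t) (at t)"
      using has_vector_derivative_mult_right[OF deriv, of "inverse (c t)"] by (simp add: field_simps)
    show "(Ln has_field_derivative inverse 1) (at (c t / c t))"
      using nz has_field_derivative_Ln[of 1] by simp
  qed
  then have "(q has_vector_derivative v / c t) (at t)" by simp
  then have "((\<lambda>s. Im (q s)) has_vector_derivative Im (v / c t)) (at t)"
    by (rule bounded_linear.has_vector_derivative[OF bounded_linear_Im])
  then have "((\<lambda>s. A t + Im (q s)) has_real_derivative 0 + Im (v / c t)) (at t)"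
    unfolding has_real_derivative_iff_has_vector_derivative
    by (intro has_vector_derivative_add has_vector_derivative_const)
  moreover have "eventually (\<lambda>s. A s = A t + Im (q s)) (nhds t)"
  proof -
    have "(A \<longlongrightarrow> A t) (nhds t)"
      using cont by (simp add: continuous_on_eq_continuous_at isCont_def tendsto_at_iff_tendsto_nhds)
    then have "eventually (\<lambda>s. dist (A s) (A t) < pi) (nhds t)"
      by (rule tendstoD) simp
    then show ?thesis
    proof (rule eventually_mono)
      fix s assume "dist (A s) (A t) < pi"
      then have *: "- pi < A s - A t" "A s - A t \<le> pi" by (auto simp: dist_real_def)
      have "c s / c t = exp (\<i> * of_real (A s - A t))"
        unfolding c cis_divide by (rule cis_conv_exp)
      then have "q s = \<i> * of_real (A s - A t)"
        using * by (simp add: q_def del: of_real_diff)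
      then show "A s = A t + Im (q s)" by simp
    qed
  qed
  ultimately have "(A has_real_derivative Im (v / c t)) (at t)"
    using DERIV_cong_ev[of t t A "\<lambda>s. A t + Im (q s)"] by simp
  moreover have "v / c t = v * cnj (c t)" by (simp add: c divide_inverse cis_cnj)
  then have "Im (v / c t) = Re (v * cnj (\<i> * c t))" by simp
  ultimately show ?thesis using pos by metis
qed

lemma circle_lift_exists:
  assumes f: "f \<in> Diff2_S1_set"
  obtains A where "circle_lift f A"
proof -
  have bij: "bij_betw f (sphere 0 1) (sphere 0 1)"
    and op: "\<And>t. Re (vector_derivative (\<lambda>\<theta>. f (cis \<theta>)) (at t) * cnj (\<i> * f (cis t))) > 0"
    using f by (auto simp: Diff2_S1_set_def Bij_def orientation_preserving_circle_def)
  obtain g' where g': "\<And>t. ((\<lambda>\<theta>. f (cis \<theta>)) has_vector_derivative g' t) (at t)"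
    using f by (auto simp: Diff2_S1_set_def C2_circle_map_def)
  have cont: "continuous_on UNIV (\<lambda>\<theta>. f (cis \<theta>))"
    using g' by (intro continuous_at_imp_continuous_on) (auto intro: has_vector_derivative_continuous)
  have norm1: "norm (f (cis t)) = 1" for t
    using bij_betwE[OF bij] by (simp add: dist_norm)
  obtain L where L: "continuous_on UNIV L" "\<And>t. f (cis t) = exp (L t)"
  proof (rule continuous_logarithm_on_contractible[OF cont])
    show "contractible (UNIV :: real set)" by (simp add: contractible_UNIV)
    show "f (cis t) \<noteq> 0" for t using norm1[of t] by auto
  qed auto
  define A where "A t = Im (L t)" for t
  have A_cont: "continuous_on UNIV A" unfolding A_def by (intro continuous_intros L(1))
  have lift: "f (cis t) = cis (A t)" for t
  proof -
    have "exp (Re (L t)) = 1" using norm1[of t] L(2)[of t] by simp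
    then show ?thesis using L(2)[of t] by (simp add: exp_eq_polar A_def)
  qed
  have "\<exists>D>0. (A has_real_derivative D) (at t)" for t
  proof (rule vector_derivative_lift_pos[OF A_cont lift g'])
    show "Re (g' t * cnj (\<i> * f (cis t))) > 0"
      using op[of t] vector_derivative_at[OF g', of t] by simp
  qed
  then have smono: "strict_mono A"
    by (intro strict_monoI) (metis DERIV_pos_imp_increasing)
  have "A (t + 2 * pi) = A t + 2 * pi" for t
  proof -
    have "cis (A (t + 2 * pi)) = cis (A t)"
      using lift[of "t + 2 * pi"] lift[of t] by (simp add: cis_mult[symmetric])
    then obtain k :: int where k: "A (t + 2 * pi) = A t + 2 * pi * k"
      by (auto simp: cis_eq_cis_iff)
    have "A t < A (t + 2 * pi)" using smono by (simp add: strict_mono_def)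
    then have "k > 0" using k by (simp add: zero_less_mult_iff)
    \<comment> \<open>Degree at least two would let \<open>A\<close> gain one full turn strictly
      inside a period, so \<open>f\<close> would take the same value at two different points of the
      circle.\<close>
    moreover have "\<not> k \<ge> 2"
    proof
      assume "k \<ge> 2"
      then have "2 * pi * 2 \<le> 2 * pi * k" by (intro mult_left_mono) auto
      then obtain s where s: "t \<le> s" "s \<le> t + 2 * pi" "A s = A t + 2 * pi"
        using IVT'[of A t "A t + 2 * pi" "t + 2 * pi"] k continuous_on_subset[OF A_cont] by auto
      then have "f (cis s) = f (cis t)" by (simp add: lift cis_mult[symmetric])
      then have "cis s = cis t"
        using bij by (auto simp: bij_betw_def dest!: inj_onD)
      then obtain m :: int where m: "s = t + 2 * pi * m" by (auto simp: cis_eq_cis_iff)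
      have "s \<noteq> t" "s \<noteq> t + 2 * pi" 
        using s(3) k \<open>2 * pi * 2 \<le> 2 * pi * k\<close> by auto
      then have "0 < 2 * pi * m" "2 * pi * m < 2 * pi * 1" using s(1,2) m by auto
      then have "0 < m" "m < 1" by (simp_all add: zero_less_mult_iff)
      then show False by simp
    qed
    ultimately have "k = 1" by simp
    then show ?thesis using k by simp
  qed
  then show thesis using that[of A] A_cont smono lift by (simp add: circle_lift_def)
qed

lemma circle_involution_lift:
  assumes A: "circle_lift f A" and inv: "\<And>t. f (f (cis t)) = cis t"
  obtains "\<And>t. f (cis t) = cis t" | A' where "circle_lift f A'" "\<And>t. A' (A' t) = t + 2 * pi"
proof -
  have "cis (A (A t)) = cis t" for t using inv[of t] circle_liftD(3)[OF A] by simp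
  moreover have "continuous_on UNIV (\<lambda>t. A (A t))"
    using circle_liftD(1)[OF A] by (auto intro: continuous_on_compose2)
  ultimately obtain k :: int where k: "\<And>t. A (A t) = t + 2 * pi * k"
    using cis_equal_lifts[of "\<lambda>t. A (A t)" "\<lambda>t. t"] by auto
  \<comment> \<open>Changing the lift by \<open>m\<close> full turns changes its square by
    \<open>2 * m\<close>, so only the parity of \<open>k\<close> is intrinsic: the even case is a
    monotone involution of the line, the odd one a square root of the translation.\<close>
  define C where "C t = A t + 2 * pi * of_int (- (k div 2))" for t
  have C: "circle_lift f C" unfolding C_def by (rule circle_lift_shift[OF A])
  have CC: "C (C t) = t + 2 * pi * of_int (k mod 2)" for t
  proof -
    have "C (C t) = A (A t) + 2 * pi * of_int (- (2 * (k div 2)))"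
      unfolding C_def circle_lift_int[OF A] by (simp add: algebra_simps)
    also have "\<dots> = t + 2 * pi * of_int (k - 2 * (k div 2))"
      by (simp add: k algebra_simps)
    finally show ?thesis by (simp add: minus_mult_div_eq_mod)
  qed
  show thesis
  proof (cases "even k")
    case True
    have "C t = t" for t
      using mono_involution_fixes[of UNIV C t] CC[of t] True circle_liftD(2)[OF C]
      by (simp add: even_iff_mod_2_eq_zero strict_mono_mono)
    then show ?thesis using that(1) circle_liftD(3)[OF C] by simp
  next
    case False
    then have "C (C t) = t + 2 * pi" for t using CC[of t] by (simp add: odd_iff_mod_2_eq_one)
    then show ?thesis using that(2)[OF C] by blast
  qed
qed

text \<open>Nontrivial involutions of the circle lift to square roots \<open>A\<close>, \<open>B\<close> of the translation by \<open>2 * pi\<close>.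
  If they commute, so do \<open>A\<close> and \<open>B\<close>; then \<open>A \<circ> B\<close> followed by the inverse translation is a monotone
  involution of the line, hence the identity.\<close>

lemma commuting_circle_involutions:
  assumes f: "f \<in> Diff2_S1_set" and g: "g \<in> Diff2_S1_set"
    and inv: "\<And>z. z \<in> sphere 0 1 \<Longrightarrow> f (f z) = z" "\<And>z. z \<in> sphere 0 1 \<Longrightarrow> g (g z) = z"
    and comm: "\<And>z. z \<in> sphere 0 1 \<Longrightarrow> f (g z) = g (f z)"
  shows "(\<forall>z\<in>sphere 0 1. f z = z) \<or> (\<forall>z\<in>sphere 0 1. g z = z) \<or> (\<forall>z\<in>sphere 0 1. f (g z) = z)"
proof -
  have cis_sphere: "cis t \<in> sphere 0 1" for t by simp
  obtain A0 where "circle_lift f A0" using circle_lift_exists[OF f] .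
  then show ?thesis
  proof (rule circle_involution_lift[OF _ inv(1)[OF cis_sphere]])
    assume "\<And>t. f (cis t) = cis t"
    then show ?thesis unfolding ball_sphere_iff_cis by blast
  next
    fix A assume A: "circle_lift f A" and AA: "\<And>t. A (A t) = t + 2 * pi"
    obtain B0 where "circle_lift g B0" using circle_lift_exists[OF g] .
    then show ?thesis
    proof (rule circle_involution_lift[OF _ inv(2)[OF cis_sphere]])
      assume "\<And>t. g (cis t) = cis t"
      then show ?thesis unfolding ball_sphere_iff_cis by blast
    next
      fix B assume B: "circle_lift g B" and BB: "\<And>t. B (B t) = t + 2 * pi"
      note lA = circle_liftD[OF A] and lB = circle_liftD[OF B]
      have "cis (A (B t)) = cis (B (A t))" for t
        using comm[OF cis_sphere[of t]] by (simp add: lA(3) lB(3))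
      moreover have "continuous_on UNIV (\<lambda>t. A (B t))" "continuous_on UNIV (\<lambda>t. B (A t))"
        using lA(1) lB(1) by (auto intro: continuous_on_compose2)
      ultimately obtain k :: int where k: "\<And>t. A (B t) = B (A t) + 2 * pi * k"
        using cis_equal_lifts[of "\<lambda>t. A (B t)" "\<lambda>t. B (A t)"] by auto
      \<comment> \<open>Moving \<open>A\<close> past \<open>B\<close> twice collects
        \<open>k\<close> twice, whereas \<open>B \<circ> B\<close> is the translation, with which
        \<open>A\<close> commutes.\<close>
      have "A (B (B 0)) = B (B (A 0)) + 2 * pi * k + 2 * pi * k"
        using k[of "B 0"] k[of 0] circle_lift_int[OF B, of "B (A 0)" k] by simp
      then have "k = 0" using BB[of 0] BB[of "A 0"] lA(4)[of 0] by simp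
      define C where "C t = A (B t) - 2 * pi" for t
      have "C t = t" for t
      proof (rule mono_involution_fixes[of UNIV])
        show "mono_on UNIV C"
          using lA(2) lB(2) by (auto simp: C_def mono_on_def strict_mono_less_eq)
        have "A (B (A (B t) - 2 * pi)) = A (B (A (B t))) - 2 * pi"
          using circle_lift_int[OF B, of "A (B t)" "-1"] circle_lift_int[OF A, of "B (A (B t))" "-1"] by simp
        moreover have "A (B (A (B t))) = A (A (B (B t)))" using k[of "B t"] \<open>k = 0\<close> by simp
        ultimately show "C (C t) = t" using AA[of "B (B t)"] BB[of t] by (simp add: C_def)
      qed auto
      then have AB: "A (B t) = t + 2 * pi" for t using C_def[of t] by (simp add: algebra_simps)
      have "f (g (cis t)) = cis t" for t
        by (simp add: lA(3) lB(3) AB cis_mult[symmetric])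
      then show ?thesis unfolding ball_sphere_iff_cis by blast
    qed
  qed
qed

subsection \<open>Homomorphisms to diffeomorphism groups\<close>

context aut_free_hom begin

text \<open>The swap of \<open>j\<close> and \<open>k\<close> conjugates one double transposition of
  the four-group into the other.\<close>

lemma double_swap_conj:
  assumes ijkl: "distinct [i, j, k, l]" "{i, j, k, l} \<subseteq> {..<n}"
    and 1: "h (letter_aut n (swap_letters i k \<circ> swap_letters j l)) = \<one>"
  shows "h (letter_aut n (swap_letters i j \<circ> swap_letters k l)) = \<one>"
proof -
  have p: "letter_inv n (swap_letters j k)" using ijkl by (intro letter_inv_swap) auto
  have q: "letter_inv n (swap_letters i k \<circ> swap_letters j l)" "letter_inv n (swap_letters i j \<circ> swap_letters k l)"
    using ijkl by (auto intro!: letter_inv_double_swap)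
  have "h (letter_aut n (swap_letters i j \<circ> swap_letters k l)) =
      h (letter_aut n (swap_letters j k)) \<otimes> h (letter_aut n (swap_letters i k \<circ> swap_letters j l)) \<otimes>
      h (letter_aut n (swap_letters j k))"
    by (rule conj_letter_aut[OF p q])
      (use ijkl in \<open>auto simp: swap_letters_def Transposition.transpose_def\<close>)
  then show ?thesis using 1 letter_aut_involution[OF p] h_closed[OF letter_aut_auto[OF p]] by simp
qed

end

text \<open>Passing to all bijections of \<open>S\<close> provides a group as target without any
  closure argument for diffeomorphisms; triviality and the size of the image are not
  affected.\<close>

lemma hom_BijGroup:
  assumes "h \<in> hom G (BijGroup S\<lparr>carrier := D\<rparr>)" "D \<subseteq> Bij S"
  shows "h \<in> hom G (BijGroup S)"
  using assms by (auto simp: hom_def BijGroup_def)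

lemma Bij_eq_one: "x \<in> Bij S \<Longrightarrow> (\<And>z. z \<in> S \<Longrightarrow> x z = z) \<Longrightarrow> x = \<one>\<^bsub>BijGroup S\<^esub>"
  by (auto simp: BijGroup_def Bij_def intro!: extensionalityI[of _ S])

lemma BijGroup_mult_apply:
  "x \<in> Bij S \<Longrightarrow> y \<in> Bij S \<Longrightarrow> z \<in> S \<Longrightarrow> (x \<otimes>\<^bsub>BijGroup S\<^esub> y) z = x (y z)"
  by (simp add: BijGroup_def compose_def)

lemma BijGroup_one_apply: "z \<in> S \<Longrightarrow> \<one>\<^bsub>BijGroup S\<^esub> z = z"
  by (simp add: BijGroup_def)

lemma hom_Aut_Diff2_S1:
  assumes n: "6 \<le> n" and hom: "h \<in> hom (Aut (free_group n)) Diff2_S1"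
  shows "finite (h ` carrier (Aut (free_group n)))" "card (h ` carrier (Aut (free_group n))) \<le> 2"
proof -
  let ?S = "sphere 0 1 :: complex set" and ?H = "BijGroup (sphere 0 1 :: complex set)"
  have sub: "Diff2_S1_set \<subseteq> Bij ?S" by (auto simp: Diff2_S1_set_def)
  interpret aut_free_hom ?H n h
    using hom_BijGroup[OF hom[unfolded Diff2_S1_def] sub] group_BijGroup
    by (simp add: aut_free_hom_def aut_free_hom_axioms_def)
  have Diff: "h \<alpha> \<in> Diff2_S1_set" if "\<alpha> \<in> AF" for \<alpha>
    using hom that Aut_simps(1) by (auto simp: hom_def Diff2_S1_def)
  interpret nielsen_collapse ?H n h
  proof (unfold_locales, fact n)
    fix i j k l assume ijkl: "distinct [i, j, k, l]" "{i, j, k, l} \<subseteq> {..<n}"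
    \<comment> \<open>The three nontrivial elements of the Klein four-group on
      \<open>i, j, k, l\<close>; the product of the first two is the third, so one of the three must
      be killed.\<close>
    define a b c where "a = swap_letters i j \<circ> swap_letters k l"
      and "b = swap_letters i k \<circ> swap_letters j l" and "c = swap_letters i l \<circ> swap_letters j k"
    have inv: "letter_inv n a" "letter_inv n b" "letter_inv n c"
      unfolding a_def b_def c_def using ijkl by (auto intro!: letter_inv_double_swap)
    note A = inv[THEN letter_aut_auto]
    have "a (b x) = c x" "b (a x) = c x" for x
      using ijkl by (auto simp: a_def b_def c_def swap_letters_def Transposition.transpose_def)
    then have "compose F (letter_aut n a) (letter_aut n b) = letter_aut n c"
      "compose F (letter_aut n b) (letter_aut n a) = letter_aut n c"
      using letter_invD(1)[OF inv(1)] letter_invD(1)[OF inv(2)]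
      by (auto intro!: compose_eqI A simp: free_end_letter letter_map_letter_inv inv)
    then have ab: "h (letter_aut n a) \<otimes>\<^bsub>?H\<^esub> h (letter_aut n b) = h (letter_aut n c)"
      "h (letter_aut n b) \<otimes>\<^bsub>?H\<^esub> h (letter_aut n a) = h (letter_aut n c)"
      using h_compose A by metis+
    note Bij = subsetD[OF sub Diff[OF A(1)]] subsetD[OF sub Diff[OF A(2)]] subsetD[OF sub Diff[OF A(3)]]
    have "(\<forall>z\<in>?S. h (letter_aut n a) z = z) \<or> (\<forall>z\<in>?S. h (letter_aut n b) z = z) \<or>
        (\<forall>z\<in>?S. h (letter_aut n a) (h (letter_aut n b) z) = z)"
    proof (rule commuting_circle_involutions[OF Diff[OF A(1)] Diff[OF A(2)]])
      fix z assume z: "z \<in> ?S"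
      show "h (letter_aut n a) (h (letter_aut n a) z) = z"
        using BijGroup_mult_apply[OF Bij(1,1) z] letter_aut_involution[OF inv(1)] BijGroup_one_apply[OF z] by simp
      show "h (letter_aut n b) (h (letter_aut n b) z) = z"
        using BijGroup_mult_apply[OF Bij(2,2) z] letter_aut_involution[OF inv(2)] BijGroup_one_apply[OF z] by simp
      show "h (letter_aut n a) (h (letter_aut n b) z) = h (letter_aut n b) (h (letter_aut n a) z)"
        using BijGroup_mult_apply[OF Bij(1,2) z] BijGroup_mult_apply[OF Bij(2,1) z] ab by simp
    qed
    then have "h (letter_aut n a) = \<one>\<^bsub>?H\<^esub> \<or> h (letter_aut n b) = \<one>\<^bsub>?H\<^esub> \<or> h (letter_aut n c) = \<one>\<^bsub>?H\<^esub>"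
      using Bij_eq_one[OF Bij(1)] Bij_eq_one[OF Bij(2)] Bij_eq_one[OF Bij(3)] 
        BijGroup_mult_apply[OF Bij(1,2)] ab(1) by metis
    \<comment> \<open>If \<open>c\<close> is the element killed, conjugation is applied with
      \<open>k\<close> and \<open>l\<close> exchanged and yields the swap with its indices in the
      other order.\<close>
    moreover have "swap_letters l k = swap_letters k l"
      by (simp add: swap_letters_def fun_eq_iff transpose_commute)
    ultimately show "h (letter_aut n (swap_letters i j \<circ> swap_letters k l)) = \<one>\<^bsub>?H\<^esub>"
      using double_swap_conj[of i j k l] double_swap_conj[of i j l k] ijkl
      by (auto simp: a_def b_def c_def)
  qed
  have sub2: "h ` carrier (Aut (free_group n)) \<subseteq> {\<one>\<^bsub>?H\<^esub>, e}"
    using image_le_two Aut_simps(1) by blast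
  then show "finite (h ` carrier (Aut (free_group n)))" by (rule finite_subset) simp
  show "card (h ` carrier (Aut (free_group n))) \<le> 2"
    using card_mono[OF _ sub2] card_length[of "[\<one>\<^bsub>?H\<^esub>, e]"] by simp
qed

text \<open>Monotonicity kills every involution, which supplies the double transpositions for the
  collapse and, applied to an inversion, also removes the remaining sign \<open>e\<close>.\<close>

lemma hom_Aut_Diff2_I:
  assumes n: "6 \<le> n" and hom: "h \<in> hom (Aut (free_group n)) Diff2_I"
  shows "h ` carrier (Aut (free_group n)) = {\<one>\<^bsub>Diff2_I\<^esub>}"
proof -
  let ?S = "{0..1} :: real set" and ?H = "BijGroup ({0..1} :: real set)"
  have sub: "Diff2_I_set \<subseteq> Bij ?S" by (auto simp: Diff2_I_set_def)
  interpret aut_free_hom ?H n h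
    using hom_BijGroup[OF hom[unfolded Diff2_I_def] sub] group_BijGroup
    by (simp add: aut_free_hom_def aut_free_hom_axioms_def)
  have Diff: "h \<alpha> \<in> Diff2_I_set" if "\<alpha> \<in> AF" for \<alpha>
    using hom that Aut_simps(1) by (auto simp: hom_def Diff2_I_def)
  have involution_trivial: "h (letter_aut n p) = \<one>\<^bsub>?H\<^esub>" if p: "letter_inv n p" for p
  proof (rule Bij_eq_one)
    note D = Diff[OF letter_aut_auto[OF p]]
    show Bij: "h (letter_aut n p) \<in> Bij ?S" using D sub by blast
    fix z assume z: "z \<in> ?S"
    show "h (letter_aut n p) z = z"
    proof (rule mono_involution_fixes)
      show "mono_on ?S (h (letter_aut n p))" using D by (simp add: Diff2_I_set_def)
      show "h (letter_aut n p) z \<in> ?S" using Bij_imp_funcset[OF Bij] z by blast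
      show "h (letter_aut n p) (h (letter_aut n p) z) = z"
        using BijGroup_mult_apply[OF Bij Bij z] letter_aut_involution[OF p] BijGroup_one_apply[OF z] by simp
    qed (fact z)
  qed
  interpret nielsen_collapse ?H n h
    by (unfold_locales, fact n) (intro involution_trivial letter_inv_double_swap)
  have "e = \<one>\<^bsub>?H\<^esub>" unfolding e_def by (intro involution_trivial letter_inv_flip)
  then have "h \<alpha> = \<one>\<^bsub>?H\<^esub>" if "\<alpha> \<in> AF" for \<alpha> using image_le_two[OF that] by simp
  moreover have "\<one>\<^bsub>Diff2_I\<^esub> = \<one>\<^bsub>?H\<^esub>" by (simp add: Diff2_I_def)
  ultimately show ?thesis using id_AF Aut_simps(1) by (auto simp: image_iff)
qed

theorem theorem1p3:
  fixes n :: nat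
  assumes "n \<ge> 6"
  shows "(\<forall>h \<in> hom (Aut (free_group n)) Diff2_S1.
            finite (h ` carrier (Aut (free_group n))) \<and> card (h ` carrier (Aut (free_group n))) \<le> 2)
       \<and> (\<forall>h \<in> hom (Aut (free_group n)) Diff2_I.
            h ` carrier (Aut (free_group n)) = {\<one>\<^bsub>Diff2_I\<^esub>})
       \<and> (\<forall>h \<in> hom (Out (free_group n)) Diff2_S1.
            finite (h ` carrier (Out (free_group n))) \<and> card (h ` carrier (Out (free_group n))) \<le> 2)
       \<and> (\<forall>h \<in> hom (Out (free_group n)) Diff2_I.
            h ` carrier (Out (free_group n)) = {\<one>\<^bsub>Diff2_I\<^esub>})"
proof (intro conjI ballI)
  fix h assume "h \<in> hom (Out (free_group n)) Diff2_S1"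
  then obtain h' where "h' \<in> hom (Aut (free_group n)) Diff2_S1"
    "h' ` carrier (Aut (free_group n)) = h ` carrier (Out (free_group n))"
    by (rule group.hom_Out_lift[OF group_free_group])
  then show "finite (h ` carrier (Out (free_group n)))" "card (h ` carrier (Out (free_group n))) \<le> 2"
    using hom_Aut_Diff2_S1[OF assms] by metis+
next
  fix h assume "h \<in> hom (Out (free_group n)) Diff2_I"
  then obtain h' where "h' \<in> hom (Aut (free_group n)) Diff2_I"
    "h' ` carrier (Aut (free_group n)) = h ` carrier (Out (free_group n))"
    by (rule group.hom_Out_lift[OF group_free_group])
  then show "h ` carrier (Out (free_group n)) = {\<one>\<^bsub>Diff2_I\<^esub>}"
    using hom_Aut_Diff2_I[OF assms] by metis
qed (use hom_Aut_Diff2_S1[OF assms] hom_Aut_Diff2_I[OF assms] in blast)+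

end
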